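(* Let $\mathrm{H}$ be a real Hilbert space. Let $f \in \Gamma_0(\cdot,\mathrm{H})$ and $\ell : \mathbb{R}_+ \to \mathrm{H}$ be given functions. Let $g : \mathbb{R}_+ \times \mathrm{H} \to \mathbb{R}$ be such that $g(t,\cdot)$ is differentiable on $\mathrm{H}$ with $\nabla_x g(t,\cdot) \in \mathcal{A}(\mathrm{H})$ for all $t \ge 0$. Then, for all $t \ge 0$, the parameterized convex minimization problem $$\operatorname*{argmin}_{x \in \mathrm{H}} \Big[ f(t,x) + g(t,x) - \langle \ell(t), x\rangle \Big]$$ admits a unique solution, denoted by $y(t)$. If moreover the following assumptions are satisfied: (i) $\ell$ is differentiable at $t=0$; (ii) $\nabla_x g \in \mathcal{A}_{\mathrm{unif}}(\cdot,\mathrm{H})$; (iii) $\nabla_x g$ is of class $C^1$ on $\mathbb{R}_+ \times \mathrm{H}$; (iv) $f$ is twice epi-differentiable at $y(0)$ for $v_0 := \ell(0) - \nabla_x g(0,y(0)) \in \partial f(0,y(0))$; (v) $d^2_e f(y(0)|v_0) \in \Gamma_0(\mathrm{H})$; then $y : \mathbb{R}_+ \to \mathrm{H}$ is differentiable at $t=0$ and $y'(0)$ is the unique solution of the convex minimization problem $$\operatorname*{argmin}_{x \in \mathrm{H}} \Big[ d^2_e f(y(0)|v_0)(x) + \tfrac12 \langle \nabla^2_{xx} g(0,y(0))(x), x\rangle + \langle \nabla^2_{tx} g(0,y(0)) - \ell'(0), x\rangle \Big].$$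
   Context: Let $\mathrm{H}$ be a real Hilbert space with scalar product $\langle\cdot,\cdot\rangle$ and norm $\|\cdot\|$; $\mathbb{R}_+=[0,+\infty)$. Differentiability at $t=0$ of functions defined on $\mathbb{R}_+$ is from the right. $\nabla_xg(t,x)$ is the gradient of $g(t,\cdot)$ at $x$; $\nabla^2_{xx}g$ and $\nabla^2_{tx}g$ denote the partial derivatives of $\nabla_xg$ with respect to $x$ and to $t$ respectively (so $\nabla^2_{xx}g(0,x)$ is a bounded linear operator on $\mathrm{H}$ and $\nabla^2_{tx}g(0,x)\in\mathrm{H}$). Set limits (always as $\tau\to0$, $\tau>0$). For a family $(S_\tau)_{\tau>0}$ of subsets of a Hilbert space: $\mathrm{w}\text{-}\limsup S_\tau$ is the set of $x$ for which there exist positive $t_n\to0$ and $x_n\rightharpoonup x$ (weakly) with $x_n\in S_{t_n}$ for all $n$; $\liminf S_\tau$ is the set of $x$ such that for every positive sequence $t_n\to0$ there exist $x_n\to x$ strongly and $N$ with $x_n\in S_{t_n}$ for all $n\ge N$. The family is M-convergent (Mosco) if $\mathrm{w}\text{-}\limsup S_\tau\subset\liminf S_\tau$, and then its limit is $\liminf S_\tau$. A family of functions $f_\tau:\mathrm{H}\to\mathbb{R}\cup\{\pm\infty\}$ is M-convergent if the epigraphs $\{(x,\lambda)\in\mathrm{H}\times\mathbb{R}: f_\tau(x)\le\lambda\}$ are M-convergent in $\mathrm{H}\times\mathbb{R}$; its limit is the function whose epigraph is the limit. $\Gamma_0(\mathrm{H})$ is the set of proper, lower semi-continuous, convex functions $\mathrm{H}\to\mathbb{R}\cup\{+\infty\}$,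 with subdifferential $\partial f(x)=\{y:\langle y,z-x\rangle\le f(z)-f(x)\ \forall z\in\mathrm{H}\}$. $\Gamma_0(\cdot,\mathrm{H})$ is the set of $f:\mathbb{R}_+\times\mathrm{H}\to\mathbb{R}\cup\{+\infty\}$ with $f(t,\cdot)\in\Gamma_0(\mathrm{H})$ for all $t\ge0$; $\partial f(t,x):=\partial(f(t,\cdot))(x)$ and $f^{-1}(\cdot,\mathbb{R}):=\{x\in\mathrm{H}: f(t,x)\in\mathbb{R}\ \forall t\ge0\}$. $\mathcal{A}(\mathrm{H})$ is the set of maps $A:\mathrm{H}\to\mathrm{H}$ that are Lipschitz continuous and strongly monotone ($\exists\alpha>0$: $\langle A(x_2)-A(x_1),x_2-x_1\rangle\ge\alpha\|x_2-x_1\|^2$ for all $x_1,x_2$). $\mathcal{A}_{\mathrm{unif}}(\cdot,\mathrm{H})$ is the set of $A:\mathbb{R}_+\times\mathrm{H}\to\mathrm{H}$ such that $A(t,\cdot)$ is Lipschitz continuous and strongly monotone for all $t\ge0$ with Lipschitz constant $M\ge0$ and strong monotonicity constant $\alpha>0$ independent of $t$. Twice epi-differentiability: for $f\in\Gamma_0(\cdot,\mathrm{H})$, $x\in f^{-1}(\cdot,\mathbb{R})$, $v\in\partial f(0,x)$, put $\Delta^2_\tau f(x|v)(w):=\frac{f(\tau,x+\tau w)-f(\tau,x)-\tau\langle v,w\rangle}{\tau^2}$. $f$ is twice epi-differentiable at $x$ for $v$ if $(\Delta^2_\tau f(x|v))_{\tau>0}$ is M-convergent; the limit function is denoted $d^2_ef(x|v):\mathrm{H}\to\mathbb{R}\cup\{\pm\infty\}$.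 Saying that $f$ is twice epi-differentiable at $x$ for $v$ includes the requirement $x\in f^{-1}(\cdot,\mathbb{R})$. *)

theory Defs
  imports "HOL-Analysis.Analysis"
begin

text \<open>
  Real Hilbert spaces are types of sort \<open>{real_inner, complete_space}\<close>.  Functions with values in
  the extended reals have type \<open>'a \<Rightarrow> ereal\<close>.  Functions on the half line \<open>[0, \<infinity>)\<close> are total
  functions on the reals of which only the values at nonnegative arguments are used.
\<close>

subsection \<open>Convex functions, minimizers, gradients\<close>

definition ereal_convex :: "('a::real_vector \<Rightarrow> ereal) \<Rightarrow> bool" where
  "ereal_convex f \<longleftrightarrow>
     (\<forall>x y. \<forall>u\<in>{0..1}. f ((1 - u) *\<^sub>R x + u *\<^sub>R y) \<le> ereal (1 - u) * f x + ereal u * f y)"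

definition lower_semicontinuous :: "('a::topological_space \<Rightarrow> ereal) \<Rightarrow> bool" where
  "lower_semicontinuous f \<longleftrightarrow> (\<forall>x. f x \<le> Liminf (at x) f)"

definition proper :: "('a \<Rightarrow> ereal) \<Rightarrow> bool" where
  "proper f \<longleftrightarrow> (\<forall>x. f x \<noteq> -\<infinity>) \<and> (\<exists>x. f x \<noteq> \<infinity>)"

definition Gamma0 :: "('a::real_inner \<Rightarrow> ereal) set" where
  "Gamma0 = {f. proper f \<and> lower_semicontinuous f \<and> ereal_convex f}"

definition Gamma0_param :: "(real \<Rightarrow> 'a::real_inner \<Rightarrow> ereal) set" where
  "Gamma0_param = {f. \<forall>t\<ge>0. f t \<in> Gamma0}"

text \<open>
  Since \<open>\<infinity> - \<infinity> = \<infinity>\<close> for extended reals, the subdifferential below is empty at the points where a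
  proper function is infinite, as it should be.
\<close>

definition subdifferential :: "('a::real_inner \<Rightarrow> ereal) \<Rightarrow> 'a \<Rightarrow> 'a set" where
  "subdifferential f x = {y. \<forall>z. ereal (y \<bullet> (z - x)) \<le> f z - f x}"

definition finite_domain :: "(real \<Rightarrow> 'a \<Rightarrow> ereal) \<Rightarrow> 'a set" where
  "finite_domain f = {x. \<forall>t\<ge>0. \<bar>f t x\<bar> \<noteq> \<infinity>}"

abbreviation minimizes :: "('a \<Rightarrow> ereal) \<Rightarrow> 'a \<Rightarrow> bool" where
  "minimizes F \<equiv> is_arg_min F (\<lambda>_. True)"

definition gradient :: "('a::real_inner \<Rightarrow> real) \<Rightarrow> 'a \<Rightarrow> 'a" where
  "gradient h x = (THE D. GDERIV h x :> D)"


subsection \<open>Lipschitz continuous and strongly monotone maps\<close>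

definition strongly_monotone :: "real \<Rightarrow> ('a::real_inner \<Rightarrow> 'a) \<Rightarrow> bool" where
  "strongly_monotone \<alpha> A \<longleftrightarrow> \<alpha> > 0 \<and>
     (\<forall>x1 x2. (A x2 - A x1) \<bullet> (x2 - x1) \<ge> \<alpha> * (norm (x2 - x1))\<^sup>2)"

definition class_A :: "('a::real_inner \<Rightarrow> 'a) set" where
  "class_A = {A. (\<exists>M. M-lipschitz_on UNIV A) \<and> (\<exists>\<alpha>. strongly_monotone \<alpha> A)}"

definition class_A_unif :: "(real \<Rightarrow> 'a::real_inner \<Rightarrow> 'a) set" where
  "class_A_unif =
     {A. \<exists>M \<alpha>. \<forall>t\<ge>0. M-lipschitz_on UNIV (A t) \<and> strongly_monotone \<alpha> (A t)}"

text \<open>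
  Class \<open>C\<^sup>1\<close> on a set, with derivatives taken within that set and continuous for the operator norm.
  On \<open>[0, \<infinity>) \<times> H\<close> this means one-sided derivatives with respect to time at \<open>t = 0\<close>.
\<close>

definition C1_on :: "'a::real_normed_vector set \<Rightarrow> ('a \<Rightarrow> 'b::real_normed_vector) \<Rightarrow> bool" where
  "C1_on S F \<longleftrightarrow> (\<exists>F' :: 'a \<Rightarrow> 'a \<Rightarrow>\<^sub>L 'b.
     (\<forall>z\<in>S. (F has_derivative blinfun_apply (F' z)) (at z within S)) \<and> continuous_on S F')"


subsection \<open>Mosco convergence as the parameter tends to 0 from the right\<close>

definition weakly_converges :: "(nat \<Rightarrow> 'a::real_inner) \<Rightarrow> 'a \<Rightarrow> bool" where
  "weakly_converges X x \<longleftrightarrow> (\<forall>h. (\<lambda>n. X n \<bullet> h) \<longlonglongrightarrow> x \<bullet> h)"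

definition weak_limsup_set :: "(real \<Rightarrow> 'a::real_inner set) \<Rightarrow> 'a set" where
  "weak_limsup_set S = {x. \<exists>t X. (\<forall>n. t n > 0) \<and> t \<longlonglongrightarrow> 0 \<and>
     weakly_converges X x \<and> (\<forall>n. X n \<in> S (t n))}"

definition liminf_set :: "(real \<Rightarrow> 'a::real_inner set) \<Rightarrow> 'a set" where
  "liminf_set S = {x. \<forall>t. (\<forall>n. t n > 0) \<and> t \<longlonglongrightarrow> 0 \<longrightarrow>
     (\<exists>X N. X \<longlonglongrightarrow> x \<and> (\<forall>n\<ge>N. X n \<in> S (t n)))}"

definition M_convergent_sets :: "(real \<Rightarrow> 'a::real_inner set) \<Rightarrow> bool" where
  "M_convergent_sets S \<longleftrightarrow> weak_limsup_set S \<subseteq> liminf_set S"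

definition ereal_epigraph :: "('a \<Rightarrow> ereal) \<Rightarrow> ('a \<times> real) set" where
  "ereal_epigraph F = {(x, r). F x \<le> ereal r}"

definition M_convergent :: "(real \<Rightarrow> 'a::real_inner \<Rightarrow> ereal) \<Rightarrow> bool" where
  "M_convergent F \<longleftrightarrow> M_convergent_sets (\<lambda>\<tau>. ereal_epigraph (F \<tau>))"

text \<open>Only meaningful for M-convergent families.\<close>

definition M_limit :: "(real \<Rightarrow> 'a::real_inner \<Rightarrow> ereal) \<Rightarrow> 'a \<Rightarrow> ereal" where
  "M_limit F = (THE \<phi>. ereal_epigraph \<phi> = liminf_set (\<lambda>\<tau>. ereal_epigraph (F \<tau>)))"


subsection \<open>Twice epi-differentiability\<close>

definition second_quotient ::
    "(real \<Rightarrow> 'a::real_inner \<Rightarrow> ereal) \<Rightarrow> 'a \<Rightarrow> 'a \<Rightarrow> real \<Rightarrow> 'a \<Rightarrow> ereal" where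
  "second_quotient f x v \<tau> w =
     (f \<tau> (x + \<tau> *\<^sub>R w) - f \<tau> x - ereal (\<tau> * (v \<bullet> w))) / ereal (\<tau>\<^sup>2)"

definition twice_epi_differentiable ::
    "(real \<Rightarrow> 'a::real_inner \<Rightarrow> ereal) \<Rightarrow> 'a \<Rightarrow> 'a \<Rightarrow> bool" where
  "twice_epi_differentiable f x v \<longleftrightarrow>
     x \<in> finite_domain f \<and> v \<in> subdifferential (f 0) x \<and> M_convergent (second_quotient f x v)"

definition second_epi_derivative ::
    "(real \<Rightarrow> 'a::real_inner \<Rightarrow> ereal) \<Rightarrow> 'a \<Rightarrow> 'a \<Rightarrow> 'a \<Rightarrow> ereal" where
  "second_epi_derivative f x v = M_limit (second_quotient f x v)"

end

(*
  Write x0 = y(0) and Q(t) = (y(t) - x0) / t.  The optimality condition for y(t) says that Q(t)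
  minimizes, up to the strongly monotone perturbation coming from the gradient of g, the second
  quotient of f.  The limit problem has a unique solution q, and Mosco convergence provides
  recovery points w(t) -> q.  Moving from w(t) towards Q(t) by at most a unit distance lowers the
  quotient by an amount controlled by strong monotonicity.  Along a sequence on which Q(t) stays
  away from q, a weak cluster point of the moved points would then violate the optimality of q.
  Moving by a bounded amount only makes an a priori bound on Q(t) unnecessary.
*)

theory Submission
  imports Defs "HOL-Complex_Analysis.Great_Picard"
begin

subsection \<open>Minimization of strongly convex functions\<close>

text \<open>The unknown Q(t) enters the estimates only through strong monotonicity, which moves the
  gradient of g in the optimality condition from y(t) to x0 + t w(t). There the expansion at x0 is
  under control because w(t) converges strongly. The resulting linear term therefore converges
  strongly and can be paired with displacements that converge only weakly.

  The limit problem needs two preparations. Its optimality condition must contain the derivative B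
  of the gradient itself, and B x is the gradient of 1/2 (B x, x) because B is symmetric, hence the
  Schwarz argument. The second epi-derivative is defined by a description, so the Mosco limit set
  must first be shown to be the epigraph of exactly one function.\<close>

text \<open>Extended-valued functions are treated as real functions on their domain
  \<open>D\<close>, so that all estimates stay in the reals; convexity of \<open>D\<close> is built
  in. In the usual normalization the modulus is \<open>2 * c\<close>.\<close>

definition strongly_convex_on :: "real \<Rightarrow> 'a::real_inner set \<Rightarrow> ('a \<Rightarrow> real) \<Rightarrow> bool" where
  "strongly_convex_on c D \<phi> \<longleftrightarrow> c > 0 \<and> (\<forall>x\<in>D. \<forall>y\<in>D. \<forall>u\<in>{0..1}.
     (1 - u) *\<^sub>R x + u *\<^sub>R y \<in> D \<and>
     \<phi> ((1 - u) *\<^sub>R x + u *\<^sub>R y) \<le>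
       (1 - u) * \<phi> x + u * \<phi> y - c * u * (1 - u) * (norm (x - y))\<^sup>2)"

text \<open>The case u = 1/2, multiplied by 4. Replacing the midpoint value by a lower bound of
  \<open>\<phi>\<close> controls the distance of two near-minimizers, which yields both the Cauchy
  property and uniqueness below.\<close>

lemma strongly_convex_on_midpoint:
  assumes "strongly_convex_on c D \<phi>" "x \<in> D" "y \<in> D"
  shows "(1/2) *\<^sub>R x + (1/2) *\<^sub>R y \<in> D"
    and "c * (norm (x - y))\<^sup>2 \<le> 2 * \<phi> x + 2 * \<phi> y - 4 * \<phi> ((1/2) *\<^sub>R x + (1/2) *\<^sub>R y)"
proof -
  have "\<forall>u\<in>{0..1}. (1 - u) *\<^sub>R x + u *\<^sub>R y \<in> D \<and>
     \<phi> ((1 - u) *\<^sub>R x + u *\<^sub>R y) \<le>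
       (1 - u) * \<phi> x + u * \<phi> y - c * u * (1 - u) * (norm (x - y))\<^sup>2"
    using assms unfolding strongly_convex_on_def by blast
  then have *: "(1 - 1/2) *\<^sub>R x + (1/2) *\<^sub>R y \<in> D \<and>
     \<phi> ((1 - 1/2) *\<^sub>R x + (1/2) *\<^sub>R y) \<le>
       (1 - 1/2) * \<phi> x + 1/2 * \<phi> y - c * (1/2) * (1 - 1/2) * (norm (x - y))\<^sup>2"
    by (rule bspec) simp
  then show "(1/2) *\<^sub>R x + (1/2) *\<^sub>R y \<in> D" by simp
  from * show "c * (norm (x - y))\<^sup>2 \<le> 2 * \<phi> x + 2 * \<phi> y - 4 * \<phi> ((1/2) *\<^sub>R x + (1/2) *\<^sub>R y)"
    by simp
qed

text \<open>Near \<open>x0\<close> the lower bound comes from closedness of the epigraph, and strong convexity along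
  the segments issuing from \<open>x0\<close> propagates it to the whole set.\<close>

lemma strongly_convex_on_bdd_below:
  assumes sc: "strongly_convex_on c D \<phi>"
    and cl: "closed {(x, r). x \<in> D \<and> \<phi> x \<le> r}"
  shows "bdd_below (\<phi> ` D)"
proof (cases "D = {}")
  case False
  then obtain x0 where x0: "x0 \<in> D" by auto
  have c: "c > 0" using sc by (simp add: strongly_convex_on_def)
  have "(x0, \<phi> x0 - 1) \<in> - {(x, r). x \<in> D \<and> \<phi> x \<le> r}" by simp
  moreover have "open (- {(x, r). x \<in> D \<and> \<phi> x \<le> r})" using cl by blast
  ultimately obtain \<delta> where \<delta>: "\<delta> > 0"
    and "ball (x0, \<phi> x0 - 1) \<delta> \<subseteq> - {(x, r). x \<in> D \<and> \<phi> x \<le> r}"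
    by (meson openE)
  then have *: "(x, \<phi> x0 - 1) \<notin> {(x, r). x \<in> D \<and> \<phi> x \<le> r}" if "dist x0 x < \<delta>" for x
    using that by (auto simp: subset_eq dist_Pair_Pair)
  have near: "\<phi> x > \<phi> x0 - 1" if "x \<in> D" "norm (x - x0) < \<delta>" for x
    using *[of x] that by (simp add: dist_norm norm_minus_commute)
  have "\<phi> x \<ge> \<phi> x0 - 1 - 2 / (\<delta>\<^sup>2 * c)" if x: "x \<in> D" for x
  proof (cases "norm (x - x0) < \<delta>")
    case True
    have "2 / (\<delta>\<^sup>2 * c) \<ge> 0" using c by simp
    then show ?thesis using near[OF x True] by linarith
  next
    case False
    define d where "d = norm (x - x0)"
    \<comment> \<open>This puts \<open>z\<close> at distance \<delta>/2 from \<open>x0\<close>,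
      inside the ball where the lower bound is known.\<close>
    define u where "u = \<delta> / (2 * d)"
    have d: "d \<ge> \<delta>" "d > 0" using False \<delta> by (auto simp: d_def)
    have u: "0 < u" "u \<le> 1/2" using d \<delta> by (auto simp: u_def field_simps)
    define z where "z = (1 - u) *\<^sub>R x0 + u *\<^sub>R x"
    have z: "z \<in> D" "\<phi> z \<le> (1 - u) * \<phi> x0 + u * \<phi> x - c * u * (1 - u) * d\<^sup>2"
      using sc x x0 u unfolding strongly_convex_on_def z_def d_def
      by (auto simp: norm_minus_commute)
    have "z - x0 = u *\<^sub>R (x - x0)" by (simp add: z_def algebra_simps)
    then have "norm (z - x0) = \<delta> / 2" using d u by (simp add: d_def[symmetric]) (simp add: u_def)
    then have "\<phi> x0 - 1 < \<phi> z" using near z \<delta> by simp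
    with z have "0 < u * (\<phi> x - \<phi> x0 + 1 / u - c * (1 - u) * d\<^sup>2)"
      using u by (simp add: algebra_simps)
    then have 1: "\<phi> x > \<phi> x0 - 1 / u + c * (1 - u) * d\<^sup>2"
      using u by (simp add: zero_less_mult_iff)
    have "c * (1 - u) * d\<^sup>2 \<ge> c * (1/2) * d\<^sup>2"
      using u c by (intro mult_right_mono mult_left_mono) auto
    with 1 have 2: "\<phi> x > \<phi> x0 - 2 * d / \<delta> + c * d\<^sup>2 / 2"
      by (simp add: u_def)
    \<comment> \<open>Completing the square in \<open>d\<close> removes the dependence on the
      distance; this is the origin of the constant 2 / (\<delta>^2 c).\<close>
    have "0 \<le> c / 2 * (d - 2 / (\<delta> * c))\<^sup>2" using c by simp
    also have "\<dots> = c * d\<^sup>2 / 2 - 2 * d / \<delta> + 2 / (\<delta>\<^sup>2 * c)"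
      using c \<delta> by (simp add: power2_eq_square field_simps)
    finally show ?thesis using 2 by simp
  qed
  then show ?thesis by (auto intro!: bdd_belowI2)
qed simp

text \<open>Strong convexity makes minimizing sequences converge in norm, so the direct method works
  here without weak compactness. The closed epigraph carries both membership in \<open>D\<close> and
  the value to the limit.\<close>

lemma strongly_convex_on_ex1_min:
  fixes \<phi> :: "'a::{real_inner,complete_space} \<Rightarrow> real"
  assumes sc: "strongly_convex_on c D \<phi>" and ne: "D \<noteq> {}"
    and cl: "closed {(x, r). x \<in> D \<and> \<phi> x \<le> r}"
  shows "\<exists>!x. x \<in> D \<and> (\<forall>y\<in>D. \<phi> x \<le> \<phi> y)"
proof -
  have c: "c > 0" using sc by (simp add: strongly_convex_on_def)
  have bdd: "bdd_below (\<phi> ` D)" using strongly_convex_on_bdd_below[OF sc cl] .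
  define m where "m = Inf (\<phi> ` D)"
  have m: "m \<le> \<phi> x" if "x \<in> D" for x
    using bdd that by (simp add: m_def cInf_lower)
  have "\<exists>x\<in>D. \<phi> x < m + 1 / real (Suc n)" for n
    using cInf_lessD[of "\<phi> ` D" "m + 1 / real (Suc n)"] ne by (auto simp: m_def)
  then obtain X where X: "\<And>n. X n \<in> D" "\<And>n. \<phi> (X n) < m + 1 / real (Suc n)" by metis
  have "Cauchy X"
  proof (rule metric_CauchyI)
    fix e :: real assume e: "e > 0"
    \<comment> \<open>Both values exceed \<open>m\<close> by less than 1/N, so the midpoint estimate
      bounds c times the squared distance by 4/N.\<close>
    obtain N where N: "4 / (c * e\<^sup>2) < real N" using reals_Archimedean2 by blast
    have "dist (X i) (X j) < e" if "i \<ge> N" "j \<ge> N" for i j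
    proof -
      have "real N > 0" using N c e by (meson divide_nonneg_pos less_le_trans not_le mult_pos_pos zero_less_power zero_le_numeral order.strict_trans1)
      have "1 / real (Suc i) < 1 / real N" "1 / real (Suc j) < 1 / real N"
        using that \<open>real N > 0\<close> by (auto intro!: divide_strict_left_mono)
      moreover have "c * (norm (X i - X j))\<^sup>2 \<le> 2 * \<phi> (X i) + 2 * \<phi> (X j) - 4 * m"
        using strongly_convex_on_midpoint[OF sc X(1) X(1), of i j] m by fastforce
      ultimately have "c * (norm (X i - X j))\<^sup>2 < 4 / real N"
        using X(2)[of i] X(2)[of j] by simp
      also have "\<dots> < c * e\<^sup>2" using N \<open>real N > 0\<close> c e by (simp add: field_simps)
      finally have "(norm (X i - X j))\<^sup>2 < e\<^sup>2" using c by simp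
      then show ?thesis using e by (simp add: dist_norm power_less_imp_less_base)
    qed
    then show "\<exists>M. \<forall>m\<ge>M. \<forall>n\<ge>M. dist (X m) (X n) < e" by blast
  qed
  then obtain x where x: "X \<longlonglongrightarrow> x" using Cauchy_convergent convergent_def by blast
  have "(\<lambda>n. m + 1 / real (Suc n)) \<longlonglongrightarrow> m + 0"
    by (intro tendsto_add tendsto_const LIMSEQ_Suc lim_1_over_n)
  then have "(\<lambda>n. (X n, m + 1 / real (Suc n))) \<longlonglongrightarrow> (x, m)"
    using tendsto_Pair[OF x] by simp
  then have "(x, m) \<in> {(x, r). x \<in> D \<and> \<phi> x \<le> r}"
    using closed_sequentially[OF cl] X by (smt (verit) case_prodI mem_Collect_eq)
  then have "x \<in> D \<and> (\<forall>y\<in>D. \<phi> x \<le> \<phi> y)" using m by force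
  moreover have "y = x'" if "y \<in> D \<and> (\<forall>z\<in>D. \<phi> y \<le> \<phi> z)" "x' \<in> D \<and> (\<forall>z\<in>D. \<phi> x' \<le> \<phi> z)" for y x'
  proof -
    have "c * (norm (y - x'))\<^sup>2 \<le> 0"
      using strongly_convex_on_midpoint[OF sc, of y x'] that by fastforce
    then show ?thesis using c by (simp add: mult_le_0_iff)
  qed
  ultimately show ?thesis by blast
qed

text \<open>The weighted parallelogram law makes this inequality an identity; \<open>L\<close>
  cancels by linearity.\<close>

lemma strongly_convex_on_norm_sq_linear:
  fixes L :: "'a::real_inner \<Rightarrow> real"
  assumes L: "bounded_linear L" and D: "convex D"
  shows "strongly_convex_on 1 D (\<lambda>x. (norm x)\<^sup>2 - L x)"
  unfolding strongly_convex_on_def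
proof (intro conjI ballI)
  interpret bounded_linear L by fact
  fix x y u assume "x \<in> D" "y \<in> D" and u: "u \<in> {0..1::real}"
  then show "(1 - u) *\<^sub>R x + u *\<^sub>R y \<in> D" using convexD_alt[OF D] by auto
  show "(norm ((1 - u) *\<^sub>R x + u *\<^sub>R y))\<^sup>2 - L ((1 - u) *\<^sub>R x + u *\<^sub>R y) \<le>
      (1 - u) * ((norm x)\<^sup>2 - L x) + u * ((norm y)\<^sup>2 - L y) - 1 * u * (1 - u) * (norm (x - y))\<^sup>2"
    unfolding power2_norm_eq_inner add scaleR
    by (simp add: algebra_simps inner_commute power2_eq_square)
qed simp

lemma closed_epigraph_continuous:
  fixes \<phi> :: "'a::real_normed_vector \<Rightarrow> real"
  assumes "closed D" "continuous_on UNIV \<phi>"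
  shows "closed {(x, r). x \<in> D \<and> \<phi> x \<le> r}"
proof -
  have "{(x, r). x \<in> D \<and> \<phi> x \<le> r} = fst -` D \<inter> {p. \<phi> (fst p) \<le> snd p}" by auto
  moreover have "closed (fst -` D :: ('a \<times> real) set)" using assms(1) by (rule closed_vimage_fst)
  moreover have "closed {p. \<phi> (fst p) \<le> snd p}"
    by (intro closed_Collect_le continuous_on_compose2[OF assms(2)] continuous_intros) auto
  ultimately show ?thesis by (simp add: closed_Int)
qed

lemma ex1_min_norm_sq_linear:
  fixes L :: "'a::{real_inner,complete_space} \<Rightarrow> real"
  assumes L: "bounded_linear L" and D: "convex D" "closed D" "D \<noteq> {}"
  shows "\<exists>x\<in>D. \<forall>y\<in>D. (norm x)\<^sup>2 - L x \<le> (norm y)\<^sup>2 - L y"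
  using strongly_convex_on_ex1_min[OF strongly_convex_on_norm_sq_linear[OF L D(1)] D(3)
      closed_epigraph_continuous[OF D(2)]]
    linear_continuous_on[OF L] by (fastforce intro!: continuous_intros)

subsection \<open>Riesz representation and weak compactness\<close>

text \<open>The minimizer of \<open>norm x ^ 2 - L x\<close> over a subspace is half the Riesz representative of \<open>L\<close>
  there.  The case of the whole space is the Riesz theorem, and a functional of the form
  \<open>inner h\<close> on a closed subspace yields the orthogonal projection of \<open>h\<close>.\<close>

lemma riesz_subspace:
  fixes L :: "'a::{real_inner,complete_space} \<Rightarrow> real"
  assumes L: "bounded_linear L" and S: "subspace S" "closed S"
  shows "\<exists>a\<in>S. \<forall>x\<in>S. L x = a \<bullet> x"
proof -
  interpret bounded_linear L by fact
  obtain a where a: "a \<in> S" and min: "\<And>y. y \<in> S \<Longrightarrow> (norm a)\<^sup>2 - L a \<le> (norm y)\<^sup>2 - L y"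
    using ex1_min_norm_sq_linear[OF L subspace_imp_convex[OF S(1)] S(2)] S(1) subspace_0 by blast
  have "L x = (2 *\<^sub>R a) \<bullet> x" if x: "x \<in> S" for x
  proof -
    \<comment> \<open>The directional derivative of the functional at its minimizer
      \<open>a\<close>.\<close>
    define b where "b = 2 * (a \<bullet> x) - L x"
    have *: "0 \<le> t * b + t\<^sup>2 * (norm x)\<^sup>2" for t
    proof -
      have "(norm a)\<^sup>2 - L a \<le> (norm (a + t *\<^sub>R x))\<^sup>2 - L (a + t *\<^sub>R x)"
        using min a x S(1) by (simp add: subspace_add subspace_scale)
      moreover have "(norm (a + t *\<^sub>R x))\<^sup>2 = (norm a)\<^sup>2 + 2 * t * (a \<bullet> x) + t\<^sup>2 * (norm x)\<^sup>2"
        unfolding power2_norm_eq_inner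
        by (simp add: inner_add inner_commute algebra_simps power2_eq_square)
      ultimately show ?thesis by (simp add: add scaleR b_def algebra_simps)
    qed
    have "b = 0"
    proof (rule ccontr)
      assume "b \<noteq> 0"
      \<comment> \<open>The added 1 makes \<open>s\<close> positive even for x = 0 and strictly
        larger than the coefficient of the square, so that t = -b/s gives a negative value.\<close>
      define s where "s = (norm x)\<^sup>2 + 1"
      have s: "s > 0" "(norm x)\<^sup>2 < s" by (auto simp: s_def add_nonneg_pos)
      have "(- b / s) * b + (- b / s)\<^sup>2 * (norm x)\<^sup>2 = (b\<^sup>2 / s\<^sup>2) * ((norm x)\<^sup>2 - s)"
        using s by (simp add: field_simps power2_eq_square)
      moreover have "\<dots> < 0" using \<open>b \<noteq> 0\<close> s by (intro mult_pos_neg) auto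
      ultimately show False using *[of "- b / s"] by simp
    qed
    then show ?thesis by (simp add: b_def)
  qed
  then show ?thesis using a S(1) by (intro bexI[of _ "2 *\<^sub>R a"]) (auto simp: subspace_scale)
qed

lemma riesz_representation:
  fixes L :: "'a::{real_inner,complete_space} \<Rightarrow> real"
  assumes "bounded_linear L"
  obtains a where "\<And>x. L x = a \<bullet> x"
  using riesz_subspace[OF assms subspace_UNIV] by auto

text \<open>The diagonal argument needs countably many test vectors, and the members of the sequence
  themselves serve, so the space may be nonseparable. Convergence spreads to all test vectors
  because the good ones form a closed subspace; the Riesz theorem turns the limit functional into a
  point.\<close>

lemma bounded_imp_weakly_convergent_subsequence:
  fixes X :: "nat \<Rightarrow> 'a::{real_inner,complete_space}"
  assumes bdd: "\<And>n. norm (X n) \<le> K"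
  obtains k x where "strict_mono (k :: nat \<Rightarrow> nat)" "weakly_converges (X \<circ> k) x"
proof -
  have K: "K \<ge> 0" using bdd[of 0] norm_ge_zero order_trans by blast
  have bound: "norm (X n \<bullet> h) \<le> K * K" if "h \<in> range X" for n h
  proof -
    have "norm (X n \<bullet> h) \<le> norm (X n) * norm h" using Cauchy_Schwarz_ineq2 by simp
    also have "\<dots> \<le> K * K" using that bdd K by (intro mult_mono) auto
    finally show ?thesis .
  qed
  have "\<exists>k :: nat \<Rightarrow> nat. strict_mono k \<and> (\<forall>h\<in>range X. \<exists>l. (\<lambda>n. X (k n) \<bullet> h) \<longlonglongrightarrow> l)"
  proof (rule function_convergent_subsequence[of "range X" "\<lambda>n h. X n \<bullet> h" "K * K"])
    show "countable (range X)" by simp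
    show "norm (X n \<bullet> h) \<le> K * K" if "h \<in> range X" for n h
      using that by (rule bound)
    fix k :: "nat \<Rightarrow> nat"
    assume "strict_mono k" "\<And>h. h \<in> range X \<Longrightarrow> \<exists>l. (\<lambda>n. X (k n) \<bullet> h) \<longlonglongrightarrow> l"
    then show "\<exists>k :: nat \<Rightarrow> nat. strict_mono k \<and>
        (\<forall>h\<in>range X. \<exists>l. (\<lambda>n. X (k n) \<bullet> h) \<longlonglongrightarrow> l)"
      by (intro exI[of _ k]) simp
  qed
  then obtain k where k: "strict_mono (k :: nat \<Rightarrow> nat)"
    and lim: "\<And>h. h \<in> range X \<Longrightarrow> \<exists>l. (\<lambda>n. X (k n) \<bullet> h) \<longlonglongrightarrow> l"
    by (elim exE conjE) (rule that, auto)
  define C where "C = {h. convergent (\<lambda>n. X (k n) \<bullet> h)}"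
  have sub: "subspace C"
    unfolding C_def by (auto intro!: subspaceI convergent_add convergent_mult convergent_const
        simp: inner_add_right inner_zero_right inner_scaleR_right)
  have "closed C"
  proof (rule closed_sequential_limits[THEN iffD2], safe)
    fix H h assume H: "\<forall>n::nat. H n \<in> C" "H \<longlonglongrightarrow> h"
    have "Cauchy (\<lambda>n. X (k n) \<bullet> h)"
    proof (rule metric_CauchyI)
      fix e :: real assume "e > 0"
      \<comment> \<open>K + 1 keeps the divisor positive when K = 0. Two approximation errors of e/4
        and a Cauchy error below e/2 will add up to less than e.\<close>
      then have "e / (4 * (K + 1)) > 0" using K by simp
      then obtain j where j: "norm (H j - h) < e / (4 * (K + 1))"
        using H(2) LIMSEQ_D by blast
      have close: "\<bar>X n \<bullet> h - X n \<bullet> H j\<bar> \<le> e / 4" for n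
      proof -
        have "\<bar>X n \<bullet> h - X n \<bullet> H j\<bar> \<le> norm (X n) * norm (H j - h)"
          using Cauchy_Schwarz_ineq2[of "X n" "h - H j"] by (simp add: inner_diff_right norm_minus_commute)
        also have "\<dots> \<le> (K + 1) * (e / (4 * (K + 1)))"
          using bdd[of n] K j by (intro mult_mono) auto
        also have "\<dots> = e / 4" using K by (simp add: field_simps)
        finally show ?thesis .
      qed
      have "Cauchy (\<lambda>n. X (k n) \<bullet> H j)"
        using H(1) by (auto simp: C_def intro: convergent_Cauchy)
      then obtain M where M: "\<And>m n. m \<ge> M \<Longrightarrow> n \<ge> M \<Longrightarrow> dist (X (k m) \<bullet> H j) (X (k n) \<bullet> H j) < e / 2"
        using \<open>e > 0\<close> by (meson half_gt_zero metric_CauchyD)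
      have "dist (X (k m) \<bullet> h) (X (k n) \<bullet> h) < e" if "m \<ge> M" "n \<ge> M" for m n
        using M[OF that] close[of "k m"] close[of "k n"] unfolding dist_real_def by linarith
      then show "\<exists>M. \<forall>m\<ge>M. \<forall>n\<ge>M. dist (X (k m) \<bullet> h) (X (k n) \<bullet> h) < e" by blast
    qed
    then show "h \<in> C" by (simp add: C_def Cauchy_convergent_iff)
  qed
  \<comment> \<open>\<open>C\<close> contains the range of \<open>X\<close> and, trivially, its orthogonal complement.\<close>
  have "C = UNIV"
  proof (intro equalityI subset_UNIV subsetI)
    fix h :: 'a
    obtain p where p: "p \<in> C" "\<And>x. x \<in> C \<Longrightarrow> h \<bullet> x = p \<bullet> x"
      using riesz_subspace[OF bounded_linear_inner_right sub \<open>closed C\<close>] by blast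
    have "X n \<in> C" for n using lim[of "X n"] by (simp add: C_def convergent_def)
    then have "X n \<bullet> (h - p) = 0" for n
      using p(2)[of "X n"] by (simp add: inner_diff_right inner_commute)
    then have "h - p \<in> C" by (simp add: C_def convergent_const)
    then show "h \<in> C" using subspace_add[OF sub p(1)] by fastforce
  qed
  then have conv: "(\<lambda>n. X (k n) \<bullet> h) \<longlonglongrightarrow> lim (\<lambda>n. X (k n) \<bullet> h)" for h
    by (auto simp: C_def convergent_LIMSEQ_iff)
  define L where "L h = lim (\<lambda>n. X (k n) \<bullet> h)" for h
  have L: "(\<lambda>n. X (k n) \<bullet> h) \<longlonglongrightarrow> L h" for h using conv by (simp add: L_def)
  have "bounded_linear L"
  proof (rule bounded_linear_intro)
    fix g h and r :: real
    show "L (g + h) = L g + L h"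
      using tendsto_add[OF L[of g] L[of h]] L[of "g + h"]
      by (simp add: inner_add_right LIMSEQ_unique)
    show "L (r *\<^sub>R h) = r *\<^sub>R L h"
      using tendsto_mult_left[OF L[of h], of r] L[of "r *\<^sub>R h"] by (simp add: LIMSEQ_unique)
    have "\<bar>X (k n) \<bullet> h\<bar> \<le> norm h * K" for n
      using Cauchy_Schwarz_ineq2[of "X (k n)" h] bdd[of "k n"]
      by (smt (verit) mult.commute mult_left_mono norm_ge_zero)
    then show "norm (L h) \<le> norm h * K"
      using tendsto_rabs[OF L[of h]] by (auto intro: LIMSEQ_le_const2)
  qed
  then obtain x where "\<And>h. L h = x \<bullet> h" by (rule riesz_representation) blast
  then have "weakly_converges (X \<circ> k) x" using L by (simp add: weakly_converges_def)
  with k show ?thesis by (rule that)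
qed

subsection \<open>Convex functions with a smooth strongly convex perturbation\<close>

lemma lower_semicontinuous_sequentially:
  fixes f :: "'a::first_countable_topology \<Rightarrow> ereal"
  assumes f: "lower_semicontinuous f" and X: "X \<longlonglongrightarrow> x" and r: "r \<longlonglongrightarrow> \<rho>"
    and le: "\<And>n. f (X n) \<le> ereal (r n)"
  shows "f x \<le> ereal \<rho>"
proof (rule ccontr)
  assume "\<not> f x \<le> ereal \<rho>"
  then have "\<exists>c. ereal \<rho> < ereal c \<and> ereal c < f x"
    using ereal_dense2 not_le by blast
  then obtain c where c: "\<rho> < c" "ereal c < f x" by auto
  have "eventually (\<lambda>y. ereal c < f y) (at x)"
    using f c(2) le_Liminf_iff[of "f x" "at x" f] by (auto simp: lower_semicontinuous_def)
  \<comment> \<open>\<open>Liminf (at x)\<close> ignores the point \<open>x\<close>, which the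
    sequence may hit; there the bound is \<open>c(2)\<close>.\<close>
  then have "eventually (\<lambda>y. ereal c < f y) (nhds x)"
    using c(2) by (simp add: eventually_nhds_conv_at)
  then have "eventually (\<lambda>n. ereal c < f (X n)) sequentially"
    using X by (rule eventually_compose_filterlim)
  moreover have "eventually (\<lambda>n. r n < c) sequentially" using order_tendstoD(2)[OF r c(1)] .
  ultimately have "eventually (\<lambda>n::nat. False) sequentially"
  proof eventually_elim
    case (elim n)
    have "ereal c < ereal (r n)" using elim(1) le by (rule order.strict_trans2)
    with elim(2) show ?case by simp
  qed
  then show False by simp
qed

text \<open>\<open>T\<close> is left free because the mean value arguments use two-sided
  derivatives, the variational inequality a one-sided one.\<close>

lemma GDERIV_along_line:
  assumes "GDERIV h (x + s *\<^sub>R d) :> D"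
  shows "((\<lambda>s. h (x + s *\<^sub>R d)) has_real_derivative D \<bullet> d) (at s within T)"
proof -
  have "((\<lambda>s. x + s *\<^sub>R d) has_derivative (\<lambda>t. t *\<^sub>R d)) (at s within T)"
    by (auto intro!: derivative_eq_intros)
  from has_derivative_compose[OF this assms[unfolded gderiv_def]]
  show ?thesis
    by (rule has_derivative_imp_has_field_derivative) (simp add: inner_commute)
qed

text \<open>Along the segment, subtract from \<open>h\<close> its linear part and the quadratic
  gain. Strong monotonicity between \<open>x\<close> and x + s d, divided by s, says that the
  remainder is nondecreasing.\<close>

lemma strongly_monotone_gradient_lower_bound:
  fixes h :: "'a::real_inner \<Rightarrow> real"
  assumes h: "\<And>x. GDERIV h x :> A x" and A: "strongly_monotone \<alpha> A"
  shows "h x + A x \<bullet> (y - x) + \<alpha> / 2 * (norm (y - x))\<^sup>2 \<le> h y"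
proof -
  define d where "d = y - x"
  define \<psi> where "\<psi> s = h (x + s *\<^sub>R d) - s * (A x \<bullet> d) - \<alpha> / 2 * s\<^sup>2 * (norm d)\<^sup>2" for s
  have "\<psi> 0 \<le> \<psi> 1"
  proof (rule DERIV_nonneg_imp_nondecreasing[where f = \<psi>])
    fix s :: real assume s: "0 \<le> s" "s \<le> 1"
    have der: "(\<psi> has_real_derivative (A (x + s *\<^sub>R d) \<bullet> d - A x \<bullet> d - \<alpha> * s * (norm d)\<^sup>2)) (at s)"
      unfolding \<psi>_def by (rule derivative_eq_intros GDERIV_along_line[OF h] refl | simp)+
    have "\<alpha> * (norm (s *\<^sub>R d))\<^sup>2 \<le> (A (x + s *\<^sub>R d) - A x) \<bullet> (s *\<^sub>R d)"
      using A unfolding strongly_monotone_def by (metis add_diff_cancel_left')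
    then have "s * (\<alpha> * s * (norm d)\<^sup>2) \<le> s * (A (x + s *\<^sub>R d) \<bullet> d - A x \<bullet> d)"
      by (simp add: power2_eq_square inner_diff_left algebra_simps)
    then have "A (x + s *\<^sub>R d) \<bullet> d - A x \<bullet> d - \<alpha> * s * (norm d)\<^sup>2 \<ge> 0"
      using s by (cases "s = 0") auto
    with der show "\<exists>y. DERIV \<psi> s :> y \<and> y \<ge> 0" by blast
  qed simp
  then show ?thesis by (simp add: \<psi>_def d_def)
qed

text \<open>Average the lower bounds based at the intermediate point \<open>z\<close>: the
  first-order terms cancel, and the quadratic ones combine through (1-u) u^2 + u (1-u)^2 = u
  (1-u).\<close>

lemma strongly_monotone_gradient_imp_strongly_convex:
  fixes h :: "'a::real_inner \<Rightarrow> real"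
  assumes h: "\<And>x. GDERIV h x :> A x" and A: "strongly_monotone \<alpha> A"
  shows "strongly_convex_on (\<alpha> / 2) UNIV h"
  unfolding strongly_convex_on_def
proof (intro conjI ballI UNIV_I)
  show "\<alpha> / 2 > 0" using A by (simp add: strongly_monotone_def)
  fix x y :: 'a and u :: real assume u: "u \<in> {0..1}"
  define z where "z = (1 - u) *\<^sub>R x + u *\<^sub>R y"
  define d where "d = x - y"
  have e: "x - z = u *\<^sub>R d" "y - z = - ((1 - u) *\<^sub>R d)"
    by (auto simp: z_def d_def algebra_simps)
  have "(1 - u) * (h z + A z \<bullet> (x - z) + \<alpha> / 2 * (norm (x - z))\<^sup>2) \<le> (1 - u) * h x"
    "u * (h z + A z \<bullet> (y - z) + \<alpha> / 2 * (norm (y - z))\<^sup>2) \<le> u * h y"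
    using u strongly_monotone_gradient_lower_bound[OF h A] by (auto intro!: mult_left_mono)
  then have "(1 - u) * (h z + A z \<bullet> (x - z) + \<alpha> / 2 * (norm (x - z))\<^sup>2) +
      u * (h z + A z \<bullet> (y - z) + \<alpha> / 2 * (norm (y - z))\<^sup>2) \<le> (1 - u) * h x + u * h y"
    by linarith
  then show "h z \<le> (1 - u) * h x + u * h y - \<alpha> / 2 * u * (1 - u) * (norm (x - y))\<^sup>2"
    unfolding e d_def[symmetric]
    by (simp add: power_mult_distrib) (simp add: field_simps power2_eq_square)
qed

section \<open>Extended-valued objectives: existence, uniqueness and first-order optimality\<close>

lemma minimizes_iff: "minimizes F x \<longleftrightarrow> (\<forall>y. F x \<le> (F y :: ereal))"
  by (auto simp: is_arg_min_def not_less)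

lemma Gamma0_not_MInfty: "f \<in> Gamma0 \<Longrightarrow> f x \<noteq> -\<infinity>"
  by (simp add: Gamma0_def proper_def)

lemma Gamma0_finite:
  assumes "f \<in> Gamma0" "f x \<noteq> \<infinity>"
  shows "f x = ereal (real_of_ereal (f x))"
  using Gamma0_not_MInfty[OF assms(1), of x] assms(2) by (cases "f x") auto

text \<open>Phrased with points of the epigraph rather than function values, so that infinities
  never enter the convex combination.\<close>

lemma Gamma0_convexD:
  assumes f: "f \<in> Gamma0" and "f x \<le> ereal r" "f y \<le> ereal s" "u \<in> {0..1}"
  shows "f ((1 - u) *\<^sub>R x + u *\<^sub>R y) \<le> ereal ((1 - u) * r + u * s)"
proof -
  have "f ((1 - u) *\<^sub>R x + u *\<^sub>R y) \<le> ereal (1 - u) * f x + ereal u * f y"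
    using f assms(4) by (simp add: Gamma0_def ereal_convex_def)
  also have "\<dots> \<le> ereal (1 - u) * ereal r + ereal u * ereal s"
    using assms(2-4) by (intro add_mono ereal_mult_left_mono) auto
  finally show ?thesis by simp
qed

lemma minimizes_Gamma0_finite:
  assumes f: "f \<in> Gamma0" and min: "minimizes (\<lambda>x. f x + ereal (h x)) x"
  shows "f x \<noteq> \<infinity>"
proof -
  obtain y where "f y \<noteq> \<infinity>" using f by (auto simp: Gamma0_def proper_def)
  moreover have "f x + ereal (h x) \<le> f y + ereal (h y)" using min unfolding minimizes_iff by blast
  ultimately show ?thesis by auto
qed

lemma Gamma0_ex1_minimizes:
  fixes f :: "'a::{real_inner,complete_space} \<Rightarrow> ereal"
  assumes f: "f \<in> Gamma0" and h: "\<And>x. GDERIV h x :> A x" and A: "strongly_monotone \<alpha> A"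
  shows "\<exists>!x. minimizes (\<lambda>x. f x + ereal (h x)) x"
proof -
  define D where "D = {x. f x \<noteq> \<infinity>}"
  \<comment> \<open>Where \<open>f\<close> is infinite, \<open>real_of_ereal\<close> returns the
    default 0; membership in \<open>D\<close> guards against this.\<close>
  define \<phi> where "\<phi> x = real_of_ereal (f x) + h x" for x
  have fD: "f x = ereal (\<phi> x - h x)" if "x \<in> D" for x
    using Gamma0_finite[OF f, of x] that by (simp add: D_def \<phi>_def)
  have D_I: "x \<in> D \<and> \<phi> x - h x \<le> r" if "f x \<le> ereal r" for x r
    using that Gamma0_not_MInfty[OF f, of x] by (cases "f x") (auto simp: D_def \<phi>_def)
  have ne: "D \<noteq> {}" using f by (auto simp: D_def Gamma0_def proper_def)
  have hc: "strongly_convex_on (\<alpha> / 2) UNIV h"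
    using strongly_monotone_gradient_imp_strongly_convex[OF h A] .
  have sc: "strongly_convex_on (\<alpha> / 2) D \<phi>"
    unfolding strongly_convex_on_def
  proof (intro conjI ballI)
    show "\<alpha> / 2 > 0" using hc by (simp add: strongly_convex_on_def)
    fix x y and u :: real assume xy: "x \<in> D" "y \<in> D" and u: "u \<in> {0..1}"
    define z where "z = (1 - u) *\<^sub>R x + u *\<^sub>R y"
    have z: "z \<in> D \<and> \<phi> z - h z \<le> (1 - u) * (\<phi> x - h x) + u * (\<phi> y - h y)"
      unfolding z_def using fD[OF xy(1)] fD[OF xy(2)] u by (intro D_I Gamma0_convexD[OF f]) auto
    moreover have "h z \<le> (1 - u) * h x + u * h y - \<alpha> / 2 * u * (1 - u) * (norm (x - y))\<^sup>2"
      using hc u unfolding strongly_convex_on_def z_def by blast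
    ultimately show "z \<in> D" "\<phi> z \<le> (1 - u) * \<phi> x + u * \<phi> y - \<alpha> / 2 * u * (1 - u) * (norm (x - y))\<^sup>2"
      by (auto simp: algebra_simps)
  qed
  have "closed {(x, r). x \<in> D \<and> \<phi> x \<le> r}"
    unfolding closed_sequential_limits
  proof (intro allI impI, elim conjE)
    fix p :: "nat \<Rightarrow> 'a \<times> real" and l
    assume p: "\<forall>n. p n \<in> {(x, r). x \<in> D \<and> \<phi> x \<le> r}" and lim: "p \<longlonglongrightarrow> l"
    have 1: "(\<lambda>n. fst (p n)) \<longlonglongrightarrow> fst l" "(\<lambda>n. snd (p n)) \<longlonglongrightarrow> snd l"
      using lim by (auto intro: tendsto_fst tendsto_snd)
    have "isCont h (fst l)"
      using h[of "fst l"] unfolding gderiv_def by (rule has_derivative_continuous)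
    then have 2: "(\<lambda>n. snd (p n) - h (fst (p n))) \<longlonglongrightarrow> snd l - h (fst l)"
      using 1 by (intro tendsto_diff) (auto intro: isCont_tendsto_compose)
    have "f (fst l) \<le> ereal (snd l - h (fst l))"
    proof (rule lower_semicontinuous_sequentially[OF _ 1(1) 2])
      show "lower_semicontinuous f" using f by (simp add: Gamma0_def)
      show "f (fst (p n)) \<le> ereal (snd (p n) - h (fst (p n)))" for n
        using p[rule_format, of n] fD by (auto simp: case_prod_beta)
    qed
    from D_I[OF this] show "l \<in> {(x, r). x \<in> D \<and> \<phi> x \<le> r}" by (auto simp: case_prod_beta)
  qed
  from strongly_convex_on_ex1_min[OF sc ne this]
  have "\<exists>!x. x \<in> D \<and> (\<forall>y\<in>D. \<phi> x \<le> \<phi> y)" .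
  moreover have "minimizes (\<lambda>x. f x + ereal (h x)) x \<longleftrightarrow> x \<in> D \<and> (\<forall>y\<in>D. \<phi> x \<le> \<phi> y)" for x
  proof
    assume min: "minimizes (\<lambda>x. f x + ereal (h x)) x"
    then have "x \<in> D" using minimizes_Gamma0_finite[OF f] by (simp add: D_def)
    moreover have "\<phi> x \<le> \<phi> y" if "y \<in> D" for y
    proof -
      have "f x + ereal (h x) \<le> f y + ereal (h y)" using min unfolding minimizes_iff by blast
      then show ?thesis using fD[OF \<open>x \<in> D\<close>] fD[OF that] by simp
    qed
    ultimately show "x \<in> D \<and> (\<forall>y\<in>D. \<phi> x \<le> \<phi> y)" by blast
  next
    assume x: "x \<in> D \<and> (\<forall>y\<in>D. \<phi> x \<le> \<phi> y)"
    have "f x + ereal (h x) \<le> f y + ereal (h y)" for y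
    proof (cases "y \<in> D")
      case True
      then show ?thesis using x fD[of x] fD[of y] by simp
    qed (simp add: D_def)
    then show "minimizes (\<lambda>x. f x + ereal (h x)) x" unfolding minimizes_iff by blast
  qed
  ultimately show ?thesis by simp
qed

text \<open>Compare \<open>y\<close> with y + u (z - y): by convexity \<open>f\<close> grows by at
  most u (f z - f y), so f y - f z is a lower bound for the difference quotient of \<open>h\<close>;
  let u tend to 0 from the right. This says that -D is a subgradient of \<open>f\<close> at
  \<open>y\<close>, written without extended subtraction.\<close>

lemma minimizes_Gamma0_variational_inequality:
  fixes f :: "'a::real_inner \<Rightarrow> ereal"
  assumes f: "f \<in> Gamma0" and h: "GDERIV h y :> D"
    and min: "minimizes (\<lambda>x. f x + ereal (h x)) y"
  shows "f y \<le> f z + ereal (D \<bullet> (z - y))"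
proof (cases "f z = \<infinity>")
  case False
  then obtain r where r: "f z = ereal r" using Gamma0_finite[OF f] by blast
  obtain s where s: "f y = ereal s"
    using Gamma0_finite[OF f minimizes_Gamma0_finite[OF f min]] by blast
  have der: "((\<lambda>u. h (y + u *\<^sub>R (z - y))) has_real_derivative D \<bullet> (z - y)) (at 0 within {0..1})"
    using h by (intro GDERIV_along_line) simp
  have "((\<lambda>u. (h (y + u *\<^sub>R (z - y)) - h (y + 0 *\<^sub>R (z - y))) / (u - 0)) \<longlongrightarrow> D \<bullet> (z - y))
      (at 0 within {0..1})"
    using der unfolding has_field_derivative_iff .
  moreover have "\<forall>\<^sub>F u in at 0 within {0..1::real}.
      s - r \<le> (h (y + u *\<^sub>R (z - y)) - h (y + 0 *\<^sub>R (z - y))) / (u - 0)"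
    unfolding eventually_at_topological
  proof (intro exI[of _ UNIV] conjI ballI impI, simp_all)
    fix u :: real assume "u \<noteq> 0" "0 \<le> u \<and> u \<le> 1"
    then have u: "0 < u \<and> u \<le> 1" by simp
    have e: "(1 - u) *\<^sub>R y + u *\<^sub>R z = y + u *\<^sub>R (z - y)" by (simp add: algebra_simps)
    have "f (y + u *\<^sub>R (z - y)) \<le> ereal ((1 - u) * s + u * r)"
      using Gamma0_convexD[OF f, of y s z r u] r s u unfolding e by simp
    moreover have "ereal s + ereal (h y) \<le> f (y + u *\<^sub>R (z - y)) + ereal (h (y + u *\<^sub>R (z - y)))"
      using min unfolding minimizes_iff s[symmetric] by blast
    ultimately have "ereal s + ereal (h y) \<le> ereal ((1 - u) * s + u * r) + ereal (h (y + u *\<^sub>R (z - y)))"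
      by (meson add_right_mono order_trans)
    then have "(s - r) * u \<le> h (y + u *\<^sub>R (z - y)) - h y" by (simp add: algebra_simps)
    then show "s - r \<le> (h (y + u *\<^sub>R (z - y)) - h y) / u" using u by (simp add: pos_le_divide_eq)
  qed
  moreover have "at (0::real) within {0..1} \<noteq> bot"
    by (simp add: at_within_Icc_at_right)
  ultimately have "s - r \<le> D \<bullet> (z - y)" by (rule tendsto_lowerbound)
  then show ?thesis by (simp add: r s)
qed simp

subsection \<open>Mosco limits\<close>

text \<open>The lower limit quantifies over all time sequences, whereas a diagonal choice produces
  one. One is enough for the weak upper limit, and M-convergence leads back to the lower
  limit.\<close>

lemma closed_liminf_set:
  assumes "M_convergent_sets S"
  shows "closed (liminf_set S)"
  unfolding closed_sequential_limits
proof (intro allI impI, elim conjE)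
  fix P p assume P: "\<forall>k::nat. P k \<in> liminf_set S" and lim: "P \<longlonglongrightarrow> p"
  have "\<exists>t x. 0 < t \<and> t < 1 / real (Suc k) \<and> x \<in> S t \<and> dist x (P k) < 1 / real (Suc k)" for k
  proof -
    have "\<exists>X N. X \<longlonglongrightarrow> P k \<and> (\<forall>n\<ge>N. X n \<in> S (1 / real (Suc n)))"
      using P[rule_format, of k, unfolded liminf_set_def mem_Collect_eq,
          rule_format, of "\<lambda>n. 1 / real (Suc n)"] LIMSEQ_Suc[OF lim_1_over_n] by simp
    then obtain X N where X: "X \<longlonglongrightarrow> P k" "\<And>n. n \<ge> N \<Longrightarrow> X n \<in> S (1 / real (Suc n))"
      by blast
    obtain N' where "\<And>n. n \<ge> N' \<Longrightarrow> dist (X n) (P k) < 1 / real (Suc k)"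
      using metric_LIMSEQ_D[OF X(1), of "1 / real (Suc k)"] by auto
    \<comment> \<open>The index exceeds all three thresholds; its extra \<open>Suc\<close> makes the
      time strictly smaller than 1/(k+1).\<close>
    then show ?thesis
      using X(2)[of "Suc (max k (max N N'))"]
      by (intro exI[of _ "1 / real (Suc (Suc (max k (max N N'))))"] exI[of _ "X (Suc (max k (max N N')))"])
        (auto intro!: divide_strict_left_mono)
  qed
  then obtain t x where t: "\<And>k. 0 < t k" "\<And>k. t k < 1 / real (Suc k)"
    and x: "\<And>k. x k \<in> S (t k)" "\<And>k. dist (x k) (P k) < 1 / real (Suc k)"
    by metis
  have lim0: "(\<lambda>n. 1 / real (Suc n)) \<longlonglongrightarrow> 0" by (rule LIMSEQ_Suc[OF lim_1_over_n])
  have "t \<longlonglongrightarrow> 0"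
    by (rule tendsto_sandwich[OF _ _ tendsto_const lim0]) (intro always_eventually allI less_imp_le t)+
  moreover have "(\<lambda>k. x k - P k) \<longlonglongrightarrow> 0"
    using x(2) by (intro Lim_null_comparison[OF _ lim0] always_eventually allI less_imp_le)
      (simp add: dist_norm)
  then have "x \<longlonglongrightarrow> p" by (rule Lim_transform[OF lim])
  then have "weakly_converges x p"
    unfolding weakly_converges_def by (intro allI tendsto_inner tendsto_const)
  ultimately have "p \<in> weak_limsup_set S"
    using t(1) x(1) unfolding weak_limsup_set_def by blast
  then show "p \<in> liminf_set S" using assms unfolding M_convergent_sets_def by blast
qed

lemma ereal_le_iff_le_real_upper_bounds: "(a :: ereal) \<le> b \<longleftrightarrow> (\<forall>r. b \<le> ereal r \<longrightarrow> a \<le> ereal r)"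
  by (metis ereal_dense2 ereal_le_real order.trans order.strict_implies_order linorder_not_le)

text \<open>An extended real, infinite or not, is determined by its real upper bounds. This is the
  uniqueness behind the description in \<open>M_limit\<close>.\<close>

lemma ereal_epigraph_inject: "ereal_epigraph F = ereal_epigraph G \<longleftrightarrow> F = G"
proof
  assume "ereal_epigraph F = ereal_epigraph G"
  then have "F x \<le> ereal r \<longleftrightarrow> G x \<le> ereal r" for x r by (auto simp: ereal_epigraph_def set_eq_iff)
  then have "F x = G x" for x
    by (auto intro!: antisym simp: ereal_le_iff_le_real_upper_bounds[of "F x" "G x"]
        ereal_le_iff_le_real_upper_bounds[of "G x" "F x"])
  then show "F = G" by blast
qed simp

text \<open>A set is an epigraph as soon as it is closed and upward closed in the real component; the
  function is recovered as the vertical infimum.\<close>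

lemma ereal_epigraph_M_limit:
  assumes M: "M_convergent F"
  shows "ereal_epigraph (M_limit F) = liminf_set (\<lambda>\<tau>. ereal_epigraph (F \<tau>))"
proof -
  define S where "S = liminf_set (\<lambda>\<tau>. ereal_epigraph (F \<tau>))"
  have cl: "closed S" unfolding S_def using M by (intro closed_liminf_set) (simp add: M_convergent_def)
  have up: "(x, s) \<in> S" if mem: "(x, r) \<in> S" and "r \<le> s" for x r s
    unfolding S_def liminf_set_def
  proof (intro CollectI allI impI)
    fix t :: "nat \<Rightarrow> real" assume "(\<forall>n. t n > 0) \<and> t \<longlonglongrightarrow> 0"
    then obtain X N where X: "X \<longlonglongrightarrow> (x, r)" "\<forall>n\<ge>N. X n \<in> ereal_epigraph (F (t n))"
      using mem unfolding S_def liminf_set_def by blast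
    have "(\<lambda>n. X n + (0, s - r)) \<longlonglongrightarrow> (x, r) + (0, s - r)"
      using X(1) by (intro tendsto_add tendsto_const)
    then have "(\<lambda>n. X n + (0, s - r)) \<longlonglongrightarrow> (x, s)" by simp
    moreover have "X n + (0, s - r) \<in> ereal_epigraph (F (t n))" if "n \<ge> N" for n
    proof -
      have "F (t n) (fst (X n)) \<le> ereal (snd (X n))"
        using X(2) that by (auto simp: ereal_epigraph_def case_prod_beta)
      also have "\<dots> \<le> ereal (snd (X n) + (s - r))" using \<open>r \<le> s\<close> by simp
      finally show ?thesis by (simp add: ereal_epigraph_def case_prod_beta)
    qed
    ultimately show "\<exists>X N. X \<longlonglongrightarrow> (x, s) \<and> (\<forall>n\<ge>N. X n \<in> ereal_epigraph (F (t n)))"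
      by blast
  qed
  \<comment> \<open>The infimum is taken in the extended reals: an empty fibre gives infinity, a
    full vertical line minus infinity.\<close>
  define \<phi> where "\<phi> x = Inf {ereal r |r. (x, r) \<in> S}" for x
  have "(x, r) \<in> S" if "\<phi> x \<le> ereal r" for x r
  proof -
    have "(x, r + 1 / real (Suc n)) \<in> S" for n
    proof -
      have "\<phi> x < ereal (r + 1 / real (Suc n))" by (rule order.strict_trans1[OF that]) simp
      then obtain s where "(x, s) \<in> S" "s < r + 1 / real (Suc n)"
        unfolding \<phi>_def Inf_less_iff by auto
      then show ?thesis using up by force
    qed
    moreover have "(\<lambda>n. (x, r + 1 / real (Suc n))) \<longlonglongrightarrow> (x, r + 0)"
      by (intro tendsto_Pair tendsto_add tendsto_const LIMSEQ_Suc[OF lim_1_over_n])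
    ultimately show ?thesis using closed_sequentially[OF cl] by fastforce
  qed
  moreover have "\<phi> x \<le> ereal r" if "(x, r) \<in> S" for x r
    unfolding \<phi>_def using that by (intro Inf_lower) blast
  ultimately have "ereal_epigraph \<phi> = S" by (auto simp: ereal_epigraph_def)
  then have "\<exists>!\<phi>. ereal_epigraph \<phi> = S" by (metis ereal_epigraph_inject)
  then show ?thesis unfolding M_limit_def S_def by (rule theI')
qed

subsection \<open>Gradients and their derivatives\<close>

text \<open>Schwarz's argument: by the mean value theorem the second difference quotient of \<open>h\<close> in
  directions \<open>d\<close> and \<open>e\<close> tends to \<open>inner (B d) e\<close>, and it is symmetric in \<open>d\<close> and \<open>e\<close>.\<close>

lemma derivative_of_gradient_symmetric:
  fixes h :: "'a::real_inner \<Rightarrow> real"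
  assumes h: "\<And>x. GDERIV h x :> A x" and A: "(A has_derivative B) (at x)"
  shows "B d \<bullet> e = B e \<bullet> d"
proof -
  interpret B: bounded_linear B using A by (rule has_derivative_bounded_linear)
  define Q where "Q d e s = (h (x + s *\<^sub>R d + s *\<^sub>R e) - h (x + s *\<^sub>R d) - h (x + s *\<^sub>R e) + h x) / s\<^sup>2"
    for d e s
  have lim: "(Q d e \<longlongrightarrow> B d \<bullet> e) (at_right 0)" for d e
  proof (rule tendstoI)
    fix \<epsilon> :: real assume \<epsilon>: "\<epsilon> > 0"
    \<comment> \<open>The two summands before the 1 come from the remainders \<open>R1\<close> and
      \<open>R2\<close>; the 1 keeps \<open>C\<close> positive when e = 0.\<close>
    define C where "C = (norm d + norm e) * norm e + norm e * norm e + 1"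
    have C: "C > 0" unfolding C_def by (intro add_nonneg_pos add_nonneg_nonneg mult_nonneg_nonneg) auto
    obtain \<delta> where \<delta>: "\<delta> > 0" and
      app: "\<And>y. norm (y - x) < \<delta> \<Longrightarrow> norm (A y - A x - B (y - x)) \<le> \<epsilon> / (2 * C) * norm (y - x)"
    proof -
      have "\<epsilon> / (2 * C) > 0" using \<epsilon> C by simp
      with A that show ?thesis unfolding has_derivative_at_alt by blast
    qed
    define \<sigma> where "\<sigma> = \<delta> / (norm d + norm e + 1)"
    have \<sigma>: "\<sigma> > 0" using \<delta> by (simp add: \<sigma>_def add_nonneg_pos)
    have "dist (Q d e s) (B d \<bullet> e) < \<epsilon>" if s: "0 < s" "s < \<sigma>" for s
    proof -
      \<comment> \<open>\<open>A\<close> is differentiable at \<open>x\<close> alone, so the mean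
        value theorem is applied once, to \<open>h\<close>, and both values of \<open>A\<close> are
        then expanded at \<open>x\<close>.\<close>
      define \<psi> where "\<psi> r = h (x + s *\<^sub>R d + r *\<^sub>R e) - h (x + r *\<^sub>R e)" for r
      have "(\<psi> has_real_derivative (A (x + s *\<^sub>R d + r *\<^sub>R e) \<bullet> e - A (x + r *\<^sub>R e) \<bullet> e)) (at r)" for r
        unfolding \<psi>_def by (intro DERIV_diff GDERIV_along_line h)
      from MVT2[OF s(1) this] obtain r where r: "0 < r" "r < s"
        and mvt: "\<psi> s - \<psi> 0 = s * (A (x + s *\<^sub>R d + r *\<^sub>R e) \<bullet> e - A (x + r *\<^sub>R e) \<bullet> e)"
        by auto
      have lt: "s * (norm d + norm e) < \<delta>"
      proof -
        have "s * (norm d + norm e) \<le> s * (norm d + norm e + 1)" using s by simp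
        also have "\<dots> < \<delta>" using s(2) unfolding \<sigma>_def by (subst (asm) pos_less_divide_eq) (auto simp: add_nonneg_pos)
        finally show ?thesis .
      qed
      have re: "r * norm e \<le> s * norm e" using r by (intro mult_right_mono) auto
      have n1: "norm (s *\<^sub>R d + r *\<^sub>R e) \<le> s * (norm d + norm e)"
        using norm_triangle_ineq[of "s *\<^sub>R d" "r *\<^sub>R e"] r s re by (simp add: algebra_simps)
      have n2: "norm (r *\<^sub>R e) \<le> s * norm e" using re r by simp
      define R1 where "R1 = A (x + s *\<^sub>R d + r *\<^sub>R e) - A x - B (s *\<^sub>R d + r *\<^sub>R e)"
      define R2 where "R2 = A (x + r *\<^sub>R e) - A x - B (r *\<^sub>R e)"
      have "norm R1 \<le> \<epsilon> / (2 * C) * norm (s *\<^sub>R d + r *\<^sub>R e)"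
        using app[of "x + s *\<^sub>R d + r *\<^sub>R e"] n1 lt by (simp add: R1_def add.assoc)
      also have "\<dots> \<le> \<epsilon> / (2 * C) * (s * (norm d + norm e))"
        using n1 \<epsilon> C by (intro mult_left_mono) auto
      finally have R1: "norm R1 \<le> \<epsilon> / (2 * C) * (s * (norm d + norm e))" .
      have "s * norm e \<le> s * (norm d + norm e)" using s by simp
      then have "norm R2 \<le> \<epsilon> / (2 * C) * norm (r *\<^sub>R e)"
        using app[of "x + r *\<^sub>R e"] n2 lt by (simp add: R2_def)
      also have "\<dots> \<le> \<epsilon> / (2 * C) * (s * norm e)"
        using n2 \<epsilon> C by (intro mult_left_mono) auto
      finally have R2: "norm R2 \<le> \<epsilon> / (2 * C) * (s * norm e)" .
      have "Q d e s = (\<psi> s - \<psi> 0) / s\<^sup>2" by (simp add: Q_def \<psi>_def)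
      also have "\<dots> = (A (x + s *\<^sub>R d + r *\<^sub>R e) - A (x + r *\<^sub>R e)) \<bullet> e / s"
        unfolding mvt using s by (simp add: power2_eq_square inner_diff_left)
      \<comment> \<open>The contributions of r e to the two expansions cancel, so the unknown
        intermediate \<open>r\<close> survives only in the remainders.\<close>
      also have "A (x + s *\<^sub>R d + r *\<^sub>R e) - A (x + r *\<^sub>R e) = s *\<^sub>R B d + (R1 - R2)"
        by (simp add: R1_def R2_def B.add B.scaleR)
      also have "\<dots> \<bullet> e / s = B d \<bullet> e + (R1 - R2) \<bullet> e / s"
        using s by (simp add: inner_add_left add_divide_distrib)
      finally have "dist (Q d e s) (B d \<bullet> e) = \<bar>(R1 - R2) \<bullet> e\<bar> / s"
        using s by (simp add: dist_real_def)
      also have "\<dots> \<le> (norm R1 + norm R2) * norm e / s"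
      proof -
        have "\<bar>(R1 - R2) \<bullet> e\<bar> \<le> norm (R1 - R2) * norm e" by (rule Cauchy_Schwarz_ineq2)
        also have "\<dots> \<le> (norm R1 + norm R2) * norm e"
          by (intro mult_right_mono norm_triangle_ineq4) simp
        finally show ?thesis using s by (simp add: divide_right_mono)
      qed
      also have "\<dots> \<le> (\<epsilon> / (2 * C) * (s * (norm d + norm e)) + \<epsilon> / (2 * C) * (s * norm e)) * norm e / s"
        using R1 R2 s by (intro divide_right_mono mult_right_mono add_mono) auto
      also have "\<dots> = \<epsilon> / (2 * C) * (C - 1)"
      proof -
        have "(k * (s * a) + k * (s * b)) * b / s = k * (a * b + b * b)" for k a b
          using s by (simp add: field_simps)
        then show ?thesis unfolding C_def by (simp only: add_diff_cancel_right')
      qed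
      also have "\<dots> < \<epsilon>"
        using \<epsilon> C by (simp add: field_simps add_pos_pos)
      finally show ?thesis .
    qed
    then show "\<forall>\<^sub>F s in at_right 0. dist (Q d e s) (B d \<bullet> e) < \<epsilon>"
      unfolding eventually_at_right_field using \<sigma> by blast
  qed
  have "Q d e = Q e d" by (auto simp: Q_def fun_eq_iff algebra_simps)
  then have "(Q e d \<longlongrightarrow> B d \<bullet> e) (at_right 0)" using lim[of d e] by simp
  from tendsto_unique[OF _ this lim[of e d]] show ?thesis by simp
qed

lemma GDERIV_gradient:
  fixes h :: "'a::{real_inner,complete_space} \<Rightarrow> real"
  assumes "h differentiable (at x)"
  shows "GDERIV h x :> gradient h x"
proof -
  obtain h' where h': "(h has_derivative h') (at x)" using assms by (auto simp: differentiable_def)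
  obtain D where "\<And>d. h' d = D \<bullet> d"
    using riesz_representation[OF has_derivative_bounded_linear[OF h']] by blast
  then have "h' = (\<lambda>d. d \<bullet> D)" by (auto simp: inner_commute)
  then have D: "GDERIV h x :> D" using h' by (simp add: gderiv_def)
  moreover have "D' = D" if "GDERIV h x :> D'" for D'
    using has_derivative_unique[OF D[unfolded gderiv_def] that[unfolded gderiv_def]]
    by (metis vector_eq_ldot)
  ultimately show ?thesis unfolding gradient_def by (rule theI)
qed

lemma strongly_monotone_diff_const:
  "strongly_monotone \<alpha> A \<Longrightarrow> strongly_monotone \<alpha> (\<lambda>x. A x - c)"
  by (simp add: strongly_monotone_def)

lemma GDERIV_inner_left: "GDERIV (\<lambda>x. c \<bullet> x) x :> c"
  unfolding gderiv_def by (auto intro!: derivative_eq_intros simp: inner_commute)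

text \<open>For a general \<open>B\<close> the symmetric part would appear; \<open>sym\<close> makes
  it \<open>B\<close> itself.\<close>

lemma GDERIV_quadratic:
  assumes B: "bounded_linear B" and sym: "\<And>d e. B d \<bullet> e = B e \<bullet> d"
  shows "GDERIV (\<lambda>x. 1 / 2 * (B x \<bullet> x) + c \<bullet> x) x :> B x + c"
proof -
  have "((\<lambda>x. 1 / 2 * (B x \<bullet> x) + c \<bullet> x) has_derivative
      (\<lambda>d. 1 / 2 * (B x \<bullet> d + B d \<bullet> x) + c \<bullet> d)) (at x)"
    by (intro has_derivative_add has_derivative_mult_right has_derivative_inner
        bounded_linear_imp_has_derivative[OF B] has_derivative_ident has_derivative_inner_right)
  also have "(\<lambda>d. 1 / 2 * (B x \<bullet> d + B d \<bullet> x) + c \<bullet> d) = (\<lambda>d. d \<bullet> (B x + c))"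
    using sym[of x] by (auto simp: inner_add_right inner_commute)
  finally show ?thesis unfolding gderiv_def .
qed

text \<open>The difference quotients in direction d, paired with d, stay above \<alpha> times the
  squared norm of d, and so does their limit. The shift by \<open>c\<close> matches the affine
  gradient of the limit objective.\<close>

lemma strongly_monotone_derivative:
  fixes A :: "'a::real_inner \<Rightarrow> 'a"
  assumes A: "strongly_monotone \<alpha> A" and B: "(A has_derivative B) (at x)"
  shows "strongly_monotone \<alpha> (\<lambda>x. B x + c)"
proof -
  interpret B: bounded_linear B using B by (rule has_derivative_bounded_linear)
  have "\<alpha> * (norm d)\<^sup>2 \<le> B d \<bullet> d" for d
  proof (rule tendsto_lowerbound)
    have "((\<lambda>s. x + s *\<^sub>R d) has_derivative (\<lambda>s. s *\<^sub>R d)) (at 0)"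
      by (auto intro!: derivative_eq_intros)
    from has_derivative_compose[OF this, of A B] B
    have "((\<lambda>s. A (x + s *\<^sub>R d)) has_derivative (\<lambda>s. B (s *\<^sub>R d))) (at 0)" by simp
    then have "((\<lambda>s. A (x + s *\<^sub>R d) \<bullet> d) has_derivative (\<lambda>s. B (s *\<^sub>R d) \<bullet> d)) (at 0)"
      by (rule has_derivative_inner_left)
    then have "((\<lambda>s. A (x + s *\<^sub>R d) \<bullet> d) has_real_derivative B d \<bullet> d) (at 0)"
      by (rule has_derivative_imp_has_field_derivative) (simp add: B.scaleR)
    then show "((\<lambda>s. (A (x + s *\<^sub>R d) \<bullet> d - A (x + 0 *\<^sub>R d) \<bullet> d) / (s - 0)) \<longlongrightarrow> B d \<bullet> d) (at 0)"
      unfolding has_field_derivative_iff .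
    show "\<forall>\<^sub>F s in at 0. \<alpha> * (norm d)\<^sup>2 \<le> (A (x + s *\<^sub>R d) \<bullet> d - A (x + 0 *\<^sub>R d) \<bullet> d) / (s - 0)"
      unfolding eventually_at_topological
    proof (intro exI[of _ UNIV] conjI ballI impI open_UNIV UNIV_I)
      fix s :: real assume s: "s \<noteq> 0"
      have "\<alpha> * (norm (s *\<^sub>R d))\<^sup>2 \<le> (A (x + s *\<^sub>R d) - A x) \<bullet> (s *\<^sub>R d)"
        using A unfolding strongly_monotone_def by (metis add_diff_cancel_left')
      then have "s\<^sup>2 * (\<alpha> * (norm d)\<^sup>2) \<le> s * (A (x + s *\<^sub>R d) \<bullet> d - A x \<bullet> d)"
        using s by (simp add: power_mult_distrib inner_diff_left) (simp add: power2_eq_square algebra_simps)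
      also have "\<dots> = s\<^sup>2 * ((A (x + s *\<^sub>R d) \<bullet> d - A x \<bullet> d) / s)"
        using s by (simp add: power2_eq_square)
      finally show "\<alpha> * (norm d)\<^sup>2 \<le> (A (x + s *\<^sub>R d) \<bullet> d - A (x + 0 *\<^sub>R d) \<bullet> d) / (s - 0)"
        using s by (simp add: mult_le_cancel_left_pos del: times_divide_eq_right)
    qed
  qed simp
  then have "\<alpha> * (norm (x2 - x1))\<^sup>2 \<le> ((B x2 + c) - (B x1 + c)) \<bullet> (x2 - x1)" for x1 x2
    by (simp only: add_diff_cancel_right B.diff[symmetric])
  then show ?thesis using A by (simp only: strongly_monotone_def) blast
qed

text \<open>The slice at time \<open>s\<close> lies entirely in the half space, so the derivative in
  space is unrestricted even at the boundary time 0.\<close>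

lemma has_derivative_partial_snd:
  assumes "(F has_derivative F') (at (s, x) within S \<times> UNIV)" "s \<in> S"
  shows "((\<lambda>x. F (s, x)) has_derivative (\<lambda>d. F' (0, d))) (at x)"
proof -
  have 1: "((\<lambda>x. (s, x)) has_derivative (\<lambda>d. (0, d))) (at x)"
    by (intro has_derivative_Pair has_derivative_const has_derivative_ident)
  have 2: "(F has_derivative F') (at (s, x) within range (\<lambda>x. (s, x)))"
    by (rule has_derivative_subset[OF assms(1)]) (use assms(2) in auto)
  from has_derivative_in_compose[OF 1 2] show ?thesis .
qed

lemma has_vector_derivative_partial_fst:
  assumes "(F has_derivative F') (at (s, x) within S \<times> UNIV)"
  shows "((\<lambda>s. F (s, x)) has_vector_derivative F' (1, 0)) (at s within S)"
proof -
  interpret F': bounded_linear F' using assms by (rule has_derivative_bounded_linear)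
  have 1: "((\<lambda>s. (s, x)) has_derivative (\<lambda>d. (d, 0))) (at s within S)"
    by (intro has_derivative_Pair has_derivative_const has_derivative_ident)
  have 2: "(F has_derivative F') (at (s, x) within (\<lambda>s. (s, x)) ` S)"
    using assms by (rule has_derivative_subset) auto
  from has_derivative_in_compose[OF 1 2]
  have "((\<lambda>s. F (s, x)) has_derivative (\<lambda>d. F' (d, 0))) (at s within S)" .
  also have "(\<lambda>d. F' (d, 0)) = (\<lambda>d. d *\<^sub>R F' (1, 0))"
    by (simp flip: F'.scaleR)
  finally show ?thesis unfolding has_vector_derivative_def .
qed

subsection \<open>Convergence of the difference quotients\<close>

text \<open>Hadamard form: the direction may vary with n, as the recovery points do. Boundedness of
  the directions turns an error small against the norm of t d into one small against t.\<close>

lemma has_derivative_sequentially: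
  assumes F: "(F has_derivative F') (at p within S)"
    and t: "\<And>n. t n > 0" "t \<longlonglongrightarrow> 0" and d: "d \<longlonglongrightarrow> d0"
    and S: "\<And>n. p + t n *\<^sub>R d n \<in> S"
  shows "(\<lambda>n. (F (p + t n *\<^sub>R d n) - F p) /\<^sub>R t n) \<longlonglongrightarrow> F' d0"
proof -
  interpret F': bounded_linear F' using F by (rule has_derivative_bounded_linear)
  have "Bseq d" using d by (meson convergentI convergent_imp_Bseq)
  then obtain K where K: "K > 0" "\<And>n. norm (d n) \<le> K" unfolding Bseq_def by blast
  define R where "R n = F (p + t n *\<^sub>R d n) - F p - F' (t n *\<^sub>R d n)" for n
  have small: "(\<lambda>n. t n *\<^sub>R d n) \<longlonglongrightarrow> 0" using tendsto_scaleR[OF t(2) d] by simp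
  have "(\<lambda>n. R n /\<^sub>R t n) \<longlonglongrightarrow> 0"
  proof (rule LIMSEQ_I)
    fix e :: real assume e: "e > 0"
    then have "e / (2 * K) > 0" using K by simp
    then obtain \<delta> where \<delta>: "\<delta> > 0"
      "\<And>y. y \<in> S \<Longrightarrow> norm (y - p) < \<delta> \<Longrightarrow> norm (F y - F p - F' (y - p)) \<le> e / (2 * K) * norm (y - p)"
      using F unfolding has_derivative_within_alt by blast
    obtain N where N: "\<And>n. n \<ge> N \<Longrightarrow> norm (t n *\<^sub>R d n) < \<delta>"
      using LIMSEQ_D[OF small \<delta>(1)] by auto
    have "norm (R n /\<^sub>R t n - 0) < e" if "n \<ge> N" for n
    proof -
      have "norm (R n) \<le> e / (2 * K) * (t n * norm (d n))"
        using \<delta>(2)[OF S[of n]] N[OF that] t(1)[of n] by (simp add: R_def)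
      also have "\<dots> \<le> e / (2 * K) * (t n * K)"
        using e K t(1)[of n] by (intro mult_left_mono) auto
      also have "\<dots> = t n * (e / 2)" using K by simp
      finally have "norm (R n) / t n \<le> e / 2" using t(1)[of n] by (simp add: pos_divide_le_eq mult.commute)
      moreover have "norm (R n /\<^sub>R t n - 0) = norm (R n) / t n"
        using t(1)[of n] by (simp add: divide_inverse)
      ultimately show ?thesis using e by linarith
    qed
    then show "\<exists>N. \<forall>n\<ge>N. norm (R n /\<^sub>R t n - 0) < e" by blast
  qed
  moreover have "(\<lambda>n. F' (d n)) \<longlonglongrightarrow> F' d0" by (rule F'.tendsto[OF d])
  ultimately have "(\<lambda>n. R n /\<^sub>R t n + F' (d n)) \<longlonglongrightarrow> 0 + F' d0" by (rule tendsto_add)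
  moreover have "R n /\<^sub>R t n + F' (d n) = (F (p + t n *\<^sub>R d n) - F p) /\<^sub>R t n" for n
  proof -
    have "F' (t n *\<^sub>R d n) = t n *\<^sub>R F' (d n)" by (rule F'.scaleR)
    then show ?thesis using t(1)[of n] by (simp add: R_def scaleR_right_diff_distrib)
  qed
  ultimately show ?thesis by simp
qed

lemma weakly_converges_inner_tendsto:
  assumes X: "weakly_converges X x" and bdd: "\<And>n. norm (X n) \<le> K" and Y: "Y \<longlonglongrightarrow> y"
  shows "(\<lambda>n. X n \<bullet> Y n) \<longlonglongrightarrow> x \<bullet> y"
proof -
  have "(\<lambda>n. X n \<bullet> (Y n - y)) \<longlonglongrightarrow> 0"
  proof (rule Lim_null_comparison)
    show "\<forall>\<^sub>F n in sequentially. norm (X n \<bullet> (Y n - y)) \<le> K * norm (Y n - y)"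
    proof (intro always_eventually allI)
      fix n
      have "norm (X n \<bullet> (Y n - y)) \<le> norm (X n) * norm (Y n - y)"
        using Cauchy_Schwarz_ineq2 by simp
      also have "\<dots> \<le> K * norm (Y n - y)" using bdd by (intro mult_right_mono) auto
      finally show "norm (X n \<bullet> (Y n - y)) \<le> K * norm (Y n - y)" .
    qed
    have "(\<lambda>n. norm (Y n - y)) \<longlonglongrightarrow> 0" using Y by (simp add: LIM_zero_iff tendsto_norm_zero_iff)
    then show "(\<lambda>n. K * norm (Y n - y)) \<longlonglongrightarrow> 0" by (rule tendsto_mult_right_zero)
  qed
  moreover have "(\<lambda>n. X n \<bullet> y) \<longlonglongrightarrow> x \<bullet> y" using X by (simp add: weakly_converges_def)
  ultimately have "(\<lambda>n. X n \<bullet> (Y n - y) + X n \<bullet> y) \<longlonglongrightarrow> 0 + x \<bullet> y" by (rule tendsto_add)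
  then show ?thesis by (simp add: inner_diff_right)
qed

text \<open>Trades extended division for a bound on \<open>f\<close>; since \<tau>^2 is positive and
  finite, the infinite values of \<open>f\<close> fit as well.\<close>

lemma second_quotient_le_iff:
  assumes "f \<tau> x = ereal a" "\<tau> > 0"
  shows "second_quotient f x v \<tau> w \<le> ereal \<rho> \<longleftrightarrow>
    f \<tau> (x + \<tau> *\<^sub>R w) \<le> ereal (a + \<tau> * (v \<bullet> w) + \<tau>\<^sup>2 * \<rho>)"
proof (cases "f \<tau> (x + \<tau> *\<^sub>R w)")
  case (real b)
  then show ?thesis
    using assms by (simp add: second_quotient_def pos_divide_le_eq algebra_simps)
next
  case PInf
  then show ?thesis using assms by (simp add: second_quotient_def)
next
  case MInf
  then show ?thesis using assms by (simp add: second_quotient_def)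
qed

text \<open>In the rescaled variable, \<open>q\<close> satisfies the optimality condition.  It bounds the second
  quotient along the segment from \<open>w\<close> to \<open>q\<close> by its value at \<open>w\<close>, with a gain that is due to
  strong monotonicity.\<close>

lemma second_quotient_segment_le:
  fixes f :: "real \<Rightarrow> 'a::real_inner \<Rightarrow> ereal"
  assumes f: "f \<tau> \<in> Gamma0" and fx: "\<bar>f \<tau> x\<bar> \<noteq> \<infinity>" and \<tau>: "\<tau> > 0"
    and opt: "\<And>z. f \<tau> (x + \<tau> *\<^sub>R q) \<le>
      f \<tau> z + ereal ((A (x + \<tau> *\<^sub>R q) - b) \<bullet> (z - (x + \<tau> *\<^sub>R q)))"
    and A: "strongly_monotone \<alpha> A"
    and w: "second_quotient f x v \<tau> w \<le> ereal \<rho>" and u: "u \<in> {0..1}"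
  shows "second_quotient f x v \<tau> (w + u *\<^sub>R (q - w)) \<le>
    ereal (\<rho> - ((A (x + \<tau> *\<^sub>R w) - b + v) /\<^sub>R \<tau>) \<bullet> (u *\<^sub>R (q - w)) - \<alpha> * (u * (norm (q - w))\<^sup>2))"
proof -
  obtain a where a: "f \<tau> x = ereal a" using fx by auto
  define p where "p = a + \<tau> * (v \<bullet> w) + \<tau>\<^sup>2 * \<rho>"
  have fw: "f \<tau> (x + \<tau> *\<^sub>R w) \<le> ereal p"
    using w unfolding p_def second_quotient_le_iff[where f = f, OF a \<tau>] .
  define e where "e = q - w"
  have q: "x + \<tau> *\<^sub>R q = (x + \<tau> *\<^sub>R w) + \<tau> *\<^sub>R e" by (simp add: e_def algebra_simps)
  have "\<alpha> * (norm (\<tau> *\<^sub>R e))\<^sup>2 \<le> (A (x + \<tau> *\<^sub>R q) - A (x + \<tau> *\<^sub>R w)) \<bullet> (\<tau> *\<^sub>R e)"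
    using A unfolding strongly_monotone_def q by (metis add_diff_cancel_left')
  then have mono: "\<alpha> * \<tau>\<^sup>2 * (norm e)\<^sup>2 \<le> \<tau> * (A (x + \<tau> *\<^sub>R q) \<bullet> e) - \<tau> * (A (x + \<tau> *\<^sub>R w) \<bullet> e)"
    by (simp add: power_mult_distrib inner_diff_left algebra_simps)
  \<comment> \<open>The height of \<open>f\<close> reached at x + \<tau> q: the optimality condition
    is tested with x + \<tau> w, and strong monotonicity replaces the gradient at x + \<tau> q by
    the one at x + \<tau> w, which produces the quadratic gain.\<close>
  define c where "c = p - \<tau> * ((A (x + \<tau> *\<^sub>R w) - b) \<bullet> e) - \<alpha> * \<tau>\<^sup>2 * (norm e)\<^sup>2"
  have "f \<tau> (x + \<tau> *\<^sub>R q) \<le> f \<tau> (x + \<tau> *\<^sub>R w) + ereal ((A (x + \<tau> *\<^sub>R q) - b) \<bullet> (- (\<tau> *\<^sub>R e)))"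
    using opt[of "x + \<tau> *\<^sub>R w"] by (simp add: q)
  also have "\<dots> \<le> ereal p + ereal ((A (x + \<tau> *\<^sub>R q) - b) \<bullet> (- (\<tau> *\<^sub>R e)))"
    by (rule add_right_mono[OF fw])
  also have "\<dots> \<le> ereal c"
    using mono by (simp add: c_def inner_diff_left algebra_simps)
  finally have "f \<tau> ((1 - u) *\<^sub>R (x + \<tau> *\<^sub>R w) + u *\<^sub>R (x + \<tau> *\<^sub>R q)) \<le> ereal ((1 - u) * p + u * c)"
    by (rule Gamma0_convexD[OF f fw _ u])
  also have "(1 - u) *\<^sub>R (x + \<tau> *\<^sub>R w) + u *\<^sub>R (x + \<tau> *\<^sub>R q) = x + \<tau> *\<^sub>R (w + u *\<^sub>R e)"
    by (simp add: e_def algebra_simps)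
  also have "(1 - u) * p + u * c = a + \<tau> * (v \<bullet> (w + u *\<^sub>R e)) +
      \<tau>\<^sup>2 * (\<rho> - ((A (x + \<tau> *\<^sub>R w) - b + v) /\<^sub>R \<tau>) \<bullet> (u *\<^sub>R e) - \<alpha> * (u * (norm e)\<^sup>2))"
    using \<tau> by (simp add: c_def p_def inner_diff_left inner_add_left inner_add_right power2_eq_square field_simps)
  finally show ?thesis
    unfolding second_quotient_le_iff[where f = f, OF a \<tau>] e_def .
qed

text \<open>If the difference quotients \<open>Q n\<close> stayed away from \<open>q\<close>, the points \<open>z n\<close> at distance at most
  \<open>1\<close> from a recovery sequence \<open>w n\<close> of \<open>q\<close>, on the segments from \<open>w n\<close> to \<open>Q n\<close>, would have a
  weak cluster point at which the subgradient inequality at \<open>q\<close> fails.\<close>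

lemma difference_quotient_frequently_close:
  fixes f :: "real \<Rightarrow> 'a::{real_inner,complete_space} \<Rightarrow> ereal" and y :: "real \<Rightarrow> 'a" and v :: 'a
  defines "\<psi> \<equiv> second_epi_derivative f (y 0) v"
  assumes f: "f \<in> Gamma0_param" and fin: "y 0 \<in> finite_domain f"
    and M: "M_convergent (second_quotient f (y 0) v)"
    and opt: "\<And>t z. t \<ge> 0 \<Longrightarrow> f t (y t) \<le> f t z + ereal ((G t (y t) - l t) \<bullet> (z - y t))"
    and v: "v = l 0 - G 0 (y 0)"
    and mono: "\<And>t. t \<ge> 0 \<Longrightarrow> strongly_monotone \<alpha> (G t)"
    and l: "(l has_vector_derivative l') (at 0 within {0..})"
    and G: "((\<lambda>(t, x). G t x) has_derivative F') (at (0, y 0) within {0..} \<times> UNIV)"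
    and q: "\<psi> q = ereal r"
    and subgrad: "\<And>z. \<psi> q \<le> \<psi> z + ereal ((F' (1, q) - l') \<bullet> (z - q))"
    and t: "\<And>n. t n > 0" "t \<longlonglongrightarrow> 0" and \<epsilon>: "\<epsilon> > 0"
  shows "\<exists>n. norm ((y (t n) - y 0) /\<^sub>R t n - q) < \<epsilon>"
proof (rule ccontr)
  define x where "x = y 0"
  define Q where "Q n = (y (t n) - x) /\<^sub>R t n" for n
  assume "\<not> (\<exists>n. norm ((y (t n) - y 0) /\<^sub>R t n - q) < \<epsilon>)"
  then have far: "\<epsilon> \<le> norm (Q n - q)" for n by (auto simp: Q_def x_def not_less)
  have \<alpha>: "\<alpha> > 0" using mono[of 0] by (simp add: strongly_monotone_def)
  have y: "y (t n) = x + t n *\<^sub>R Q n" for n using t(1)[of n] by (simp add: Q_def)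
  have epi: "ereal_epigraph \<psi> = liminf_set (\<lambda>\<tau>. ereal_epigraph (second_quotient f x v \<tau>))"
    unfolding \<psi>_def second_epi_derivative_def x_def by (rule ereal_epigraph_M_limit[OF M])
  have wsub: "weak_limsup_set (\<lambda>\<tau>. ereal_epigraph (second_quotient f x v \<tau>)) \<subseteq> ereal_epigraph \<psi>"
    using M unfolding epi M_convergent_def M_convergent_sets_def x_def .
  have "(q, r) \<in> ereal_epigraph \<psi>" by (simp add: ereal_epigraph_def q)
  then obtain P N0 where P: "P \<longlonglongrightarrow> (q, r)"
    and P_epi: "\<And>n. n \<ge> N0 \<Longrightarrow> P n \<in> ereal_epigraph (second_quotient f x v (t n))"
    unfolding epi liminf_set_def using t by blast
  define w where "w n = fst (P n)" for n
  define \<rho> where "\<rho> n = snd (P n)" for n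
  have w: "w \<longlonglongrightarrow> q" and \<rho>: "\<rho> \<longlonglongrightarrow> r"
    using tendsto_fst[OF P] tendsto_snd[OF P] by (simp_all add: w_def[abs_def] \<rho>_def[abs_def])
  have quot_w: "second_quotient f x v (t n) (w n) \<le> ereal (\<rho> n)" if "n \<ge> N0" for n
    using P_epi[OF that] by (simp add: ereal_epigraph_def w_def \<rho>_def case_prod_beta)
  obtain N1 where N1: "\<And>n. n \<ge> N1 \<Longrightarrow> norm (w n - q) < \<epsilon> / 2"
    using LIMSEQ_D[OF w, of "\<epsilon> / 2"] \<epsilon> by auto
  \<comment> \<open>By the choice of \<open>v\<close> this is a difference quotient of
    \<open>G\<close> in the direction (1, w n) minus one of \<open>l\<close>, hence strongly
    convergent.\<close>
  define E where "E n = (G (t n) (x + t n *\<^sub>R w n) - l (t n) + v) /\<^sub>R t n" for n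
  define E0 where "E0 = F' (1, q) - l'"
  have E: "E \<longlonglongrightarrow> E0"
  proof -
    have 1: "(\<lambda>n. ((\<lambda>(t, x). G t x) ((0, y 0) + t n *\<^sub>R (1, w n)) - (\<lambda>(t, x). G t x) (0, y 0)) /\<^sub>R t n)
        \<longlonglongrightarrow> F' (1, q)"
      by (rule has_derivative_sequentially[OF G t tendsto_Pair[OF tendsto_const w]])
        (use t(1) in \<open>auto simp: less_imp_le\<close>)
    have 2: "(\<lambda>n. (l (0 + t n *\<^sub>R 1) - l 0) /\<^sub>R t n) \<longlonglongrightarrow> 1 *\<^sub>R l'"
      by (rule has_derivative_sequentially[OF l[unfolded has_vector_derivative_def] t tendsto_const])
        (use t(1) in \<open>auto simp: less_imp_le\<close>)
    have "E = (\<lambda>n. (G (t n) (x + t n *\<^sub>R w n) - G 0 x) /\<^sub>R t n - (l (t n) - l 0) /\<^sub>R t n)"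
      unfolding E_def[abs_def] v x_def by (simp add: algebra_simps)
    then show ?thesis using tendsto_diff[OF 1 2] by (simp add: E0_def x_def)
  qed
  \<comment> \<open>The step stops at \<open>Q n\<close> or at unit length, whichever comes first.
    If \<open>Q n\<close> equals \<open>w n\<close>, division by zero gives u n = 0, and
    \<open>uQ\<close> still holds.\<close>
  define u where "u n = min 1 (1 / norm (Q n - w n))" for n
  have u: "u n \<in> {0..1}" for n by (simp add: u_def)
  define z where "z n = w n + u n *\<^sub>R (Q n - w n)" for n
  have uQ: "u n * norm (Q n - w n) = min 1 (norm (Q n - w n))" for n
    by (auto simp: u_def min_def divide_simps)
  have zw: "norm (z n - w n) \<le> 1" for n using u[of n] uQ[of n] by (simp add: z_def)
  \<comment> \<open>Since \<open>w n\<close> is within \<epsilon>/2 of \<open>q\<close>, it is at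
    least \<epsilon>/2 away from \<open>Q n\<close>. As u is at most 1, the gain dominates the
    squared step length.\<close>
  define \<delta> where "\<delta> = (min 1 (\<epsilon> / 2))\<^sup>2"
  have \<delta>: "\<delta> > 0" using \<epsilon> by (simp add: \<delta>_def)
  have gain: "\<delta> \<le> u n * (norm (Q n - w n))\<^sup>2" if "n \<ge> N1" for n
  proof -
    have "norm (Q n - q) \<le> norm (Q n - w n) + norm (w n - q)"
      using norm_triangle_ineq[of "Q n - w n" "w n - q"] by simp
    then have "min 1 (\<epsilon> / 2) \<le> u n * norm (Q n - w n)"
      unfolding uQ using far[of n] N1[OF that] by linarith
    then have "\<delta> \<le> (u n * norm (Q n - w n))\<^sup>2"
      unfolding \<delta>_def using \<epsilon> by (intro power_mono) auto
    also have "\<dots> = u n * (u n * (norm (Q n - w n))\<^sup>2)" by (simp add: power2_eq_square)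
    also have "\<dots> \<le> 1 * (u n * (norm (Q n - w n))\<^sup>2)"
      using u[of n] by (intro mult_right_mono) auto
    finally show ?thesis by simp
  qed
  define R where "R n = \<rho> n - E n \<bullet> (z n - w n) - \<alpha> * \<delta>" for n
  have quot_z: "second_quotient f x v (t n) (z n) \<le> ereal (R n)" if n: "n \<ge> max N0 N1" for n
  proof -
    have "second_quotient f x v (t n) (z n) \<le>
        ereal (\<rho> n - E n \<bullet> (u n *\<^sub>R (Q n - w n)) - \<alpha> * (u n * (norm (Q n - w n))\<^sup>2))"
      unfolding z_def E_def
    proof (rule second_quotient_segment_le)
      show "f (t n) \<in> Gamma0" using f t(1)[of n] by (simp add: Gamma0_param_def)
      show "\<bar>f (t n) x\<bar> \<noteq> \<infinity>" using fin t(1)[of n] by (simp add: finite_domain_def x_def)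
      show "f (t n) (x + t n *\<^sub>R Q n) \<le> f (t n) p +
          ereal ((G (t n) (x + t n *\<^sub>R Q n) - l (t n)) \<bullet> (p - (x + t n *\<^sub>R Q n)))" for p
        using opt[of "t n" p] t(1)[of n] by (simp add: y)
    qed (use t(1)[of n] mono u quot_w n in auto)
    also have "\<dots> \<le> ereal (R n)"
      using gain[of n] n \<alpha> by (simp add: R_def z_def)
    finally show ?thesis .
  qed
  have "Bseq w" using w by (meson convergentI convergent_imp_Bseq)
  then obtain K where K: "\<And>n. norm (w n) \<le> K" unfolding Bseq_def by blast
  have "norm (z n) \<le> K + 1" for n
    using norm_triangle_ineq[of "z n - w n" "w n"] zw[of n] K[of n] by simp
  then obtain k0 z0 where k0: "strict_mono (k0 :: nat \<Rightarrow> nat)" and z0: "weakly_converges (z \<circ> k0) z0"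
    using bounded_imp_weakly_convergent_subsequence by blast
  \<comment> \<open>The upper limit asks for membership at every index, so the initial segment is
    skipped.\<close>
  define k where "k n = k0 (n + max N0 N1)" for n
  have k: "strict_mono k" using k0 by (simp add: k_def[abs_def] strict_mono_def)
  have kN: "k n \<ge> max N0 N1" for n using seq_suble[OF k0, of "n + max N0 N1"] unfolding k_def by linarith
  have zk: "(\<lambda>n. z (k n) \<bullet> h) \<longlonglongrightarrow> z0 \<bullet> h" for h
    using LIMSEQ_ignore_initial_segment[of "\<lambda>n. z (k0 n) \<bullet> h" "z0 \<bullet> h" "max N0 N1"] z0
    by (simp add: weakly_converges_def k_def)
  have wk: "(\<lambda>n. w (k n)) \<longlonglongrightarrow> q" and \<rho>k: "(\<lambda>n. \<rho> (k n)) \<longlonglongrightarrow> r"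
    and Ek: "(\<lambda>n. E (k n)) \<longlonglongrightarrow> E0" and tk: "(\<lambda>n. t (k n)) \<longlonglongrightarrow> 0"
    using LIMSEQ_subseq_LIMSEQ[OF w k] LIMSEQ_subseq_LIMSEQ[OF \<rho> k]
      LIMSEQ_subseq_LIMSEQ[OF E k] LIMSEQ_subseq_LIMSEQ[OF t(2) k] by (simp_all add: comp_def)
  have "weakly_converges (\<lambda>n. z (k n) - w (k n)) (z0 - q)"
    unfolding weakly_converges_def inner_diff_left
    by (intro allI tendsto_diff zk tendsto_inner[OF wk tendsto_const])
  then have "(\<lambda>n. (z (k n) - w (k n)) \<bullet> E (k n)) \<longlonglongrightarrow> (z0 - q) \<bullet> E0"
    by (rule weakly_converges_inner_tendsto[OF _ zw Ek])
  from tendsto_diff[OF tendsto_diff[OF \<rho>k this] tendsto_const[of "\<alpha> * \<delta>"]]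
  have R: "(\<lambda>n. R (k n)) \<longlonglongrightarrow> r - E0 \<bullet> (z0 - q) - \<alpha> * \<delta>"
    by (simp add: R_def inner_commute)
  have "weakly_converges (\<lambda>n. (z (k n), R (k n))) (z0, r - E0 \<bullet> (z0 - q) - \<alpha> * \<delta>)"
    unfolding weakly_converges_def
  proof
    fix h :: "'a \<times> real"
    show "(\<lambda>n. (z (k n), R (k n)) \<bullet> h) \<longlonglongrightarrow> (z0, r - E0 \<bullet> (z0 - q) - \<alpha> * \<delta>) \<bullet> h"
      using tendsto_add[OF zk[of "fst h"] tendsto_mult[OF R tendsto_const[of "snd h"]]]
      by (simp add: inner_prod_def)
  qed
  moreover have "(z (k n), R (k n)) \<in> ereal_epigraph (second_quotient f x v (t (k n)))" for n
    using quot_z[OF kN] by (simp add: ereal_epigraph_def)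
  ultimately have "(z0, r - E0 \<bullet> (z0 - q) - \<alpha> * \<delta>) \<in>
      weak_limsup_set (\<lambda>\<tau>. ereal_epigraph (second_quotient f x v \<tau>))"
    unfolding weak_limsup_set_def mem_Collect_eq
    by (intro exI[of _ "\<lambda>n. t (k n)"] exI[of _ "\<lambda>n. (z (k n), R (k n))"] conjI allI t(1) tk)
  then have "\<psi> z0 \<le> ereal (r - E0 \<bullet> (z0 - q) - \<alpha> * \<delta>)"
    using wsub by (auto simp: ereal_epigraph_def)
  then have "\<psi> z0 + ereal (E0 \<bullet> (z0 - q)) \<le> ereal (r - E0 \<bullet> (z0 - q) - \<alpha> * \<delta>) + ereal (E0 \<bullet> (z0 - q))"
    by (rule add_right_mono)
  also have "\<dots> = ereal (r - \<alpha> * \<delta>)" by simp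
  finally have "ereal r \<le> ereal (r - \<alpha> * \<delta>)"
    using order_trans[OF subgrad[of z0]] unfolding q E0_def by blast
  then show False using mult_pos_pos[OF \<alpha> \<delta>] by simp
qed

text \<open>If the limit fails, there is a null sequence all of whose quotients are far from
  \<open>q\<close>; hence one close term per sequence suffices.\<close>

lemma has_vector_derivative_at_0_sequentiallyI:
  fixes y :: "real \<Rightarrow> 'a::real_normed_vector"
  assumes "\<And>t \<epsilon>. (\<And>n. t n > 0) \<Longrightarrow> t \<longlonglongrightarrow> 0 \<Longrightarrow> \<epsilon> > 0 \<Longrightarrow>
    \<exists>n::nat. norm ((y (t n) - y 0) /\<^sub>R t n - q) < \<epsilon>"
  shows "(y has_vector_derivative q) (at 0 within {0..})"
proof -
  have ev: "\<forall>\<^sub>F s in at_right 0. norm ((y s - y 0) /\<^sub>R s - q) < \<epsilon>" if "\<epsilon> > 0" for \<epsilon>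
  proof (rule ccontr)
    assume no: "\<not> ?thesis"
    have "\<exists>s. 0 < s \<and> s < 1 / real (Suc n) \<and> \<epsilon> \<le> norm ((y s - y 0) /\<^sub>R s - q)" for n
    proof (rule ccontr)
      assume "\<not> ?thesis"
      then have "\<forall>s>0. s < 1 / real (Suc n) \<longrightarrow> norm ((y s - y 0) /\<^sub>R s - q) < \<epsilon>"
        by (meson not_le)
      moreover have "1 / real (Suc n) > 0" by simp
      ultimately show False using no unfolding eventually_at_right_field by blast
    qed
    then obtain t where t: "\<And>n. 0 < t n" "\<And>n. t n < 1 / real (Suc n)"
      and far: "\<And>n. \<epsilon> \<le> norm ((y (t n) - y 0) /\<^sub>R t n - q)" by metis
    have "t \<longlonglongrightarrow> 0"
      by (rule tendsto_sandwich[OF _ _ tendsto_const LIMSEQ_Suc[OF lim_1_over_n]])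
        (intro always_eventually allI less_imp_le t)+
    from assms[OF t(1) this \<open>\<epsilon> > 0\<close>] far show False by (meson not_le)
  qed
  have "((\<lambda>s. (y s - (y 0 + (s - 0) *\<^sub>R q)) /\<^sub>R norm (s - 0)) \<longlongrightarrow> 0) (at 0 within {0..})"
    unfolding at_within_Ici_at_right
  proof (rule tendstoI)
    fix \<epsilon> :: real assume "\<epsilon> > 0"
    show "\<forall>\<^sub>F s in at_right 0. dist ((y s - (y 0 + (s - 0) *\<^sub>R q)) /\<^sub>R norm (s - 0)) 0 < \<epsilon>"
      using ev[OF \<open>\<epsilon> > 0\<close>] eventually_at_right_less[of 0]
    proof eventually_elim
      case (elim s)
      have "(y s - (y 0 + (s - 0) *\<^sub>R q)) /\<^sub>R norm (s - 0) = (y s - y 0) /\<^sub>R s - q"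
        using elim(2) by (simp add: scaleR_diff_right algebra_simps)
      then show ?case using elim(1) by (simp add: dist_norm)
    qed
  qed
  then show ?thesis
    unfolding has_vector_derivative_def has_derivative_within
    by (simp add: bounded_linear_scaleR_left divide_inverse_commute)
qed

theorem proposition44:
  fixes f :: "real \<Rightarrow> 'a::{real_inner, complete_space} \<Rightarrow> ereal"
    and l :: "real \<Rightarrow> 'a"
    and g :: "real \<Rightarrow> 'a \<Rightarrow> real"
  assumes f: "f \<in> Gamma0_param"
    and g_diff: "\<forall>t\<ge>0. \<forall>x. g t differentiable (at x)"
    and g_grad: "\<forall>t\<ge>0. gradient (g t) \<in> class_A"
  shows "(\<forall>t\<ge>0. \<exists>!x. minimizes (\<lambda>x. f t x + ereal (g t x) - ereal (l t \<bullet> x)) x) \<and>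
    (\<forall>y v0.
      (\<forall>t\<ge>0. minimizes (\<lambda>x. f t x + ereal (g t x) - ereal (l t \<bullet> x)) (y t)) \<and>
      v0 = l 0 - gradient (g 0) (y 0) \<and>
      l differentiable (at 0 within {0..}) \<and>
      (\<lambda>t. gradient (g t)) \<in> class_A_unif \<and>
      C1_on ({0..} \<times> UNIV) (\<lambda>(t, x). gradient (g t) x) \<and>
      twice_epi_differentiable f (y 0) v0 \<and>
      second_epi_derivative f (y 0) v0 \<in> Gamma0
      \<longrightarrow>
      y differentiable (at 0 within {0..}) \<and>
      (\<forall>z. minimizes
             (\<lambda>x. second_epi_derivative f (y 0) v0 x
                + ereal (1 / 2 * (frechet_derivative (gradient (g 0)) (at (y 0)) x \<bullet> x))
                + ereal ((vector_derivative (\<lambda>t. gradient (g t) (y 0)) (at 0 within {0..})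
                          - vector_derivative l (at 0 within {0..})) \<bullet> x)) z
           \<longleftrightarrow> z = vector_derivative y (at 0 within {0..})))"
proof (intro conjI allI impI)
  have grad: "GDERIV (g t) x :> gradient (g t) x" if "t \<ge> 0" for t x
    using g_diff that by (intro GDERIV_gradient) auto
  have h: "GDERIV (\<lambda>x. g t x - l t \<bullet> x) x :> gradient (g t) x - l t" if "t \<ge> 0" for t x
    by (rule GDERIV_diff[OF grad[OF that] GDERIV_inner_left])
  have obj: "f t x + ereal (g t x) - ereal (l t \<bullet> x) = f t x + ereal (g t x - l t \<bullet> x)" for t x
    by (cases "f t x") auto
  show "\<exists>!x. minimizes (\<lambda>x. f t x + ereal (g t x) - ereal (l t \<bullet> x)) x" if t: "t \<ge> 0" for t
  proof -
    obtain \<alpha> where "strongly_monotone \<alpha> (gradient (g t))"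
      using g_grad t unfolding class_A_def by blast
    from strongly_monotone_diff_const[OF this] show ?thesis
      unfolding obj using f t by (intro Gamma0_ex1_minimizes[OF _ h]) (auto simp: Gamma0_param_def)
  qed
  fix y v0
  assume A: "(\<forall>t\<ge>0. minimizes (\<lambda>x. f t x + ereal (g t x) - ereal (l t \<bullet> x)) (y t)) \<and>
      v0 = l 0 - gradient (g 0) (y 0) \<and>
      l differentiable (at 0 within {0..}) \<and>
      (\<lambda>t. gradient (g t)) \<in> class_A_unif \<and>
      C1_on ({0..} \<times> UNIV) (\<lambda>(t, x). gradient (g t) x) \<and>
      twice_epi_differentiable f (y 0) v0 \<and>
      second_epi_derivative f (y 0) v0 \<in> Gamma0"
  define \<psi> where "\<psi> = second_epi_derivative f (y 0) v0"
  have \<psi>: "\<psi> \<in> Gamma0" unfolding \<psi>_def using A by blast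
  have bot: "at (0::real) within {0..} \<noteq> bot" by (simp add: at_within_Ici_at_right)
  define l' where "l' = vector_derivative l (at 0 within {0..})"
  have l': "(l has_vector_derivative l') (at 0 within {0..})"
    unfolding l'_def using A by (simp add: vector_derivative_works)
  \<comment> \<open>One constant for all times keeps the gain from vanishing as t tends to
    0.\<close>
  obtain \<alpha> where \<alpha>: "\<And>t. t \<ge> 0 \<Longrightarrow> strongly_monotone \<alpha> (gradient (g t))"
    using A unfolding class_A_unif_def by blast
  obtain F' where "((\<lambda>(t, x). gradient (g t) x) has_derivative blinfun_apply (F' (0, y 0)))
      (at (0, y 0) within {0..} \<times> UNIV)"
    using A unfolding C1_on_def by fastforce
  then obtain G' where G': "((\<lambda>(t, x). gradient (g t) x) has_derivative G')
      (at (0, y 0) within {0..} \<times> UNIV)" by blast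
  interpret G': bounded_linear G' using G' by (rule has_derivative_bounded_linear)
  define B where "B d = G' (0, d)" for d
  have B: "(gradient (g 0) has_derivative B) (at (y 0))"
    using has_derivative_partial_snd[OF G'] by (simp add: B_def[abs_def])
  have frechet: "frechet_derivative (gradient (g 0)) (at (y 0)) = B"
    using frechet_derivative_at[OF B] by simp
  have time: "vector_derivative (\<lambda>t. gradient (g t) (y 0)) (at 0 within {0..}) = G' (1, 0)"
    using has_vector_derivative_partial_fst[OF G'] by (intro vector_derivative_within[OF bot]) simp
  define c where "c = G' (1, 0) - l'"
  have h2: "GDERIV (\<lambda>x. 1 / 2 * (B x \<bullet> x) + c \<bullet> x) x :> B x + c" for x
    using has_derivative_bounded_linear[OF B] derivative_of_gradient_symmetric[OF grad B]
    by (intro GDERIV_quadratic) auto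
  define \<Phi> where "\<Phi> x = \<psi> x + ereal (1 / 2 * (B x \<bullet> x) + c \<bullet> x)" for x
  have "\<exists>!x. minimizes \<Phi> x"
    unfolding \<Phi>_def using strongly_monotone_derivative[OF \<alpha> B]
    by (intro Gamma0_ex1_minimizes[OF \<psi> h2]) auto
  then obtain q where q: "\<And>z. minimizes \<Phi> z \<longleftrightarrow> z = q" by metis
  have min_q: "minimizes (\<lambda>x. \<psi> x + ereal (1 / 2 * (B x \<bullet> x) + c \<bullet> x)) q"
    using q[of q] by (simp add: \<Phi>_def[abs_def])
  obtain r where r: "\<psi> q = ereal r"
    using Gamma0_finite[OF \<psi> minimizes_Gamma0_finite[OF \<psi> min_q]] by blast
  \<comment> \<open>Linearity merges the partial derivatives into the derivative in direction (1,
    q), the limit of the directions (1, w n).\<close>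
  have "B q + c = G' (1, q) - l'"
    using G'.add[of "(0, q)" "(1, 0)"] by (simp add: B_def c_def)
  then have subgrad: "\<psi> q \<le> \<psi> z + ereal ((G' (1, q) - l') \<bullet> (z - q))" for z
    using minimizes_Gamma0_variational_inequality[OF \<psi> h2 min_q] by simp
  have opt: "f t (y t) \<le> f t z + ereal ((gradient (g t) (y t) - l t) \<bullet> (z - y t))" if t: "t \<ge> 0" for t z
    using A f t unfolding obj
    by (intro minimizes_Gamma0_variational_inequality[OF _ h]) (auto simp: Gamma0_param_def)
  have y': "(y has_vector_derivative q) (at 0 within {0..})"
  proof (rule has_vector_derivative_at_0_sequentiallyI)
    fix t :: "nat \<Rightarrow> real" and \<epsilon> :: real
    assume t: "\<And>n. t n > 0" "t \<longlonglongrightarrow> 0" and \<epsilon>: "\<epsilon> > 0"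
    have twice: "y 0 \<in> finite_domain f" "M_convergent (second_quotient f (y 0) v0)"
      and v0: "v0 = l 0 - gradient (g 0) (y 0)"
      using A by (auto simp: twice_epi_differentiable_def)
    show "\<exists>n. norm ((y (t n) - y 0) /\<^sub>R t n - q) < \<epsilon>"
      by (rule difference_quotient_frequently_close[OF f twice opt v0 \<alpha> l' G'
            r[unfolded \<psi>_def] subgrad[unfolded \<psi>_def] t \<epsilon>])
  qed
  then show "y differentiable (at 0 within {0..})" by (rule differentiableI_vector)
  have "vector_derivative y (at 0 within {0..}) = q"
    by (rule vector_derivative_within[OF bot y'])
  then show "minimizes
      (\<lambda>x. second_epi_derivative f (y 0) v0 x
        + ereal (1 / 2 * (frechet_derivative (gradient (g 0)) (at (y 0)) x \<bullet> x))
        + ereal ((vector_derivative (\<lambda>t. gradient (g t) (y 0)) (at 0 within {0..})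
                  - vector_derivative l (at 0 within {0..})) \<bullet> x)) z
    \<longleftrightarrow> z = vector_derivative y (at 0 within {0..})" for z
    using q[of z]
    by (simp only: frechet time flip: \<psi>_def l'_def) (simp add: \<Phi>_def[abs_def] c_def add.assoc)
qed

end
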